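(* Let $d\geqslant 3$ and $n>1$ be integers with $n\equiv 1\pmod{d}$. Then $$\sum_{k=0}^{M}[2dk-1]\frac{(q^{-1};q^d)_k^{2d}}{(q^d;q^d)_k^{2d}}\,q^{d^2k}\equiv 0\pmod{[n]\Phi_n(q)^3}$$ holds both for $M=((d-1)n+1)/d$ and for $M=n-1$.
   Context: Here $q$ is an indeterminate. The $q$-shifted factorial is $(a;q)_k=(1-a)(1-aq)\cdots(1-aq^{k-1})$, with $(a;q)_0=1$; thus $(q^{-1};q^d)_k=\prod_{j=0}^{k-1}(1-q^{-1+dj})$. The $q$-integer is $[m]=[m]_q=\frac{1-q^m}{1-q}$ for any integer $m$ (so $[m]=1+q+\cdots+q^{m-1}$ for $m\geqslant 1$ and $[-1]=-q^{-1}$). $\Phi_n(q)=\prod_{1\leqslant k\leqslant n,\ \gcd(n,k)=1}(q-\zeta^k)$, with $\zeta$ a primitive $n$-th root of unity, is the $n$-th cyclotomic polynomial. For rational functions $A(q),B(q)\in\mathbb{Q}(q)$ and a polynomial $P(q)$, the congruence $A(q)\equiv B(q)\pmod{P(q)}$ means that $P(q)$ divides the numerator of $A(q)-B(q)$ written in lowest terms, as polynomials in $q$ over $\mathbb{Q}$. *)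

theory Defs
  imports
    "HOL-Number_Theory.Cong"
    "HOL-Computational_Algebra.Computational_Algebra"
    "HOL-Computational_Algebra.Field_as_Ring"
    Complex_Main
begin

section \<open>Rational functions in one indeterminate\<close>

text \<open>The field \<open>\<rat>(q)\<close> is \<^typ>\<open>rat poly fract\<close>.\<close>

definition qvar :: "rat poly fract" where
  "qvar = to_fract [:0, 1:]"

text \<open>
  \<^term>\<open>quot_of_fract\<close> is the library's representation in lowest terms
  (coprime numerator and denominator, denominator monic); the zero function is \<open>0 / 1\<close>.
\<close>

definition ratfun_cong :: "rat poly fract \<Rightarrow> rat poly fract \<Rightarrow> rat poly \<Rightarrow> bool" where
  "ratfun_cong A B P \<longleftrightarrow> P dvd fst (quot_of_fract (A - B))"


section \<open>\<open>q\<close>-integers and \<open>q\<close>-shifted factorials\<close>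

definition qpoch :: "'a::field \<Rightarrow> 'a \<Rightarrow> nat \<Rightarrow> 'a" where
  "qpoch a q k = (\<Prod>j<k. 1 - a * q ^ j)"

definition qint :: "'a::field \<Rightarrow> int \<Rightarrow> 'a" where
  "qint q m = (1 - q powi m) / (1 - q)"

text \<open>
  Moduli are polynomials, so \<open>[n]\<close> is also needed as a polynomial;
  the lemma \<open>to_fract_qint_poly\<close> below identifies the two.
\<close>

definition qint_poly :: "nat \<Rightarrow> rat poly" where
  "qint_poly n = (\<Sum>k<n. monom 1 k)"

lemma to_fract_power: "to_fract (p ^ n) = to_fract p ^ n"
  by (induction n) simp_all

lemma to_fract_sum: "to_fract (sum f A) = (\<Sum>x\<in>A. to_fract (f x))"
  by (induction A rule: infinite_finite_induct) simp_all

lemma qvar_neq_0: "qvar \<noteq> 0"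
  by (simp add: qvar_def)

lemma qvar_neq_1: "qvar \<noteq> 1"
proof
  assume "qvar = 1"
  then have "to_fract [:0, 1:] = to_fract (1 :: rat poly)"
    by (simp add: qvar_def)
  then show False
    by (simp only: to_fract_eq_iff) (simp add: one_pCons)
qed

lemma to_fract_qint_poly: "to_fract (qint_poly n) = qint qvar (int n)"
proof -
  have "to_fract (qint_poly n) = (\<Sum>k<n. qvar ^ k)"
    by (simp add: qint_poly_def to_fract_sum qvar_def monom_altdef to_fract_power)
  also have "\<dots> = qint qvar (int n)"
    using qvar_neq_1 by (simp add: qint_def geometric_sum power_int_def divide_simps)
                        (simp add: algebra_simps)
  finally show ?thesis .
qed

lemma qint_minus_1: "qint qvar (-1) = - inverse qvar"
  using qvar_neq_0 qvar_neq_1 by (simp add: qint_def power_int_minus field_simps)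


text \<open>The division in the first truncation bound of the theorem is exact.\<close>

lemma truncation_bound_dvd:
  fixes d n :: nat
  assumes "[n = 1] (mod d)" and "d > 0"
  shows "d dvd (d - 1) * n + 1"
proof -
  have "[(d - 1) * n + 1 = (d - 1) * 1 + 1] (mod d)"
    using assms(1) by (intro cong_add cong_mult cong_refl)
  then have "[(d - 1) * n + 1 = d] (mod d)"
    using assms(2) by simp
  then show ?thesis
    by (metis cong_dvd_iff dvd_refl cong_sym)
qed


section \<open>Cyclotomic polynomials\<close>

definition cyclotomic_complex :: "nat \<Rightarrow> complex poly" where
  "cyclotomic_complex n =
     (\<Prod>k\<in>{k\<in>{1..n}. gcd n k = 1}. [:- (cis (2 * pi / real n) ^ k), 1:])"

text \<open>
  The product above has rational coefficients, and \<open>cyclotomic n\<close> is that polynomial over \<open>\<rat>\<close>;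
  \<open>of_rat_cyclotomic\<close> below shows that the description is satisfied.
\<close>

definition cyclotomic :: "nat \<Rightarrow> rat poly" where
  "cyclotomic n = (THE p. map_poly of_rat p = cyclotomic_complex n)"

lemma map_poly_of_rat_mult:
  "map_poly of_rat (p * q) = (map_poly of_rat p * map_poly of_rat q :: complex poly)"
  by (intro poly_eqI) (simp add: coeff_map_poly coeff_mult of_rat_sum of_rat_mult)

lemma map_poly_of_rat_add:
  "map_poly of_rat (p + q) = (map_poly of_rat p + map_poly of_rat q :: complex poly)"
  by (intro poly_eqI) (simp add: coeff_map_poly of_rat_add)

lemma map_poly_of_rat_prod:
  "map_poly of_rat (prod f A) = (\<Prod>x\<in>A. map_poly of_rat (f x) :: complex poly)"
  by (induction A rule: infinite_finite_induct) (simp_all add: map_poly_of_rat_mult)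

lemma map_poly_of_rat_inj:
  assumes "map_poly of_rat p = (map_poly of_rat q :: complex poly)"
  shows "p = q"
proof (rule poly_eqI)
  fix i
  show "coeff p i = coeff q i"
    using arg_cong[OF assms, of "\<lambda>r. coeff r i"] by (simp add: coeff_map_poly)
qed

lemma degree_map_poly_of_rat: "degree (map_poly of_rat p :: complex poly) = degree p"
  by (rule degree_map_poly) simp

lemma cis_mult_pow: "cis (2 * pi / real n) ^ k = cis (2 * pi * real k / real n)"
  by (simp add: DeMoivre mult_ac)

lemma prod_roots_of_unity:
  assumes "n > 0"
  shows "(\<Prod>k\<in>{1..n}. [:- (cis (2 * pi / real n) ^ k), 1:]) = monom 1 n - 1"
proof -
  let ?z = "cis (2 * pi / real n)"
  have zn: "?z ^ n = 1"
    using assms by (simp add: DeMoivre)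
  have "bij_betw (\<lambda>k. cis (2 * pi * real k / real n)) {..<n} {z. z ^ n = 1}"
    using bij_betw_roots_unity[OF assms] .
  then have bij: "bij_betw (\<lambda>k. ?z ^ k) {..<n} {z. z ^ n = 1}"
    by (simp only: cis_mult_pow)
  have "(\<Prod>k\<in>{1..n}. [:- (?z ^ k), 1:]) = (\<Prod>k\<in>{..<n}. [:- (?z ^ k), 1:])"
    by (rule prod.reindex_bij_witness[of _ "\<lambda>k. if k = 0 then n else k" "\<lambda>k. if k = n then 0 else k"])
       (use assms zn in \<open>auto split: if_splits\<close>)
  also have "\<dots> = (\<Prod>z\<in>{z. z ^ n = 1}. [:- z, 1:])"
    by (rule prod.reindex_bij_betw[OF bij])
  also have "\<dots> = monom 1 n - 1"
  proof (rule ccontr)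
    let ?S = "{z::complex. z ^ n = 1}"
    let ?P = "\<Prod>z\<in>?S. [:- z, 1:]"
    let ?D = "?P - (monom 1 n - 1)"
    assume "\<not> ?thesis"
    then have D: "?D \<noteq> 0" by simp
    have fin: "finite ?S" and card: "card ?S = n"
      using assms by (auto intro: finite_roots_unity simp: card_roots_unity_eq)
    have degP: "degree ?P = n"
      using card by (subst degree_prod_eq_sum_degree) auto
    have leadP: "lead_coeff ?P = 1"
      by (simp add: lead_coeff_prod)
    have "coeff ?D i = 0" if "i \<ge> n" for i
    proof (cases "i = n")
      case True
      then show ?thesis using degP leadP assms by simp
    next
      case False
      then show ?thesis using that degP assms by (simp add: coeff_eq_0)
    qed
    then have "degree ?D < n"
      using D by (metis leading_coeff_0_iff not_le)
    moreover have "?S \<subseteq> {x. poly ?D x = 0}"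
      using fin by (auto simp: poly_prod poly_monom)
    then have "n \<le> card {x. poly ?D x = 0}"
      using card D by (metis card_mono poly_roots_finite)
    ultimately show False
      using card_poly_roots_bound[OF D] by linarith
  qed
  finally show ?thesis .
qed

lemma prod_cyclotomic_complex:
  assumes "n > 0"
  shows "(\<Prod>m\<in>{m. m dvd n}. cyclotomic_complex m) = monom 1 n - 1"
proof -
  let ?f = "\<lambda>k. [:- (cis (2 * pi / real n) ^ k), 1:]"
  let ?A = "\<lambda>m. {k\<in>{1..n}. gcd n k = n div m}"
  have fin: "finite {m. m dvd n}" using assms by simp
  have "cyclotomic_complex m = prod ?f (?A m)" if "m dvd n" for m
  proof -
    from that obtain c where c: "n = m * c" by (elim dvdE)
    have pos: "m > 0" "c > 0" using c assms by auto
    have pw: "cis (2 * pi / real n) ^ (k * c) = cis (2 * pi / real m) ^ k" for k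
      using pos by (simp add: DeMoivre c field_simps)
    show ?thesis
      unfolding cyclotomic_complex_def
    proof (rule prod.reindex_bij_witness[of _ "\<lambda>k. k div c" "\<lambda>k. k * c"])
      fix k assume "k \<in> ?A m"
      then have k: "1 \<le> k" "k \<le> n" "gcd n k = c" using pos c by auto
      then have "c dvd k" by (metis gcd_dvd2)
      then obtain l where l: "k = l * c" by (metis dvdE mult.commute)
      have "gcd m l * c = c" using k(3) unfolding c l by (metis gcd_mult_distrib_nat mult.commute)
      then have "gcd m l = 1" using pos by simp
      then show "k div c * c = k" "k div c \<in> {k \<in> {1..m}. gcd m k = 1}"
        using k pos l c by auto
    next
      fix k assume k: "k \<in> {k \<in> {1..m}. gcd m k = 1}"
      have "gcd n (k * c) = c"
        using k gcd_mult_distrib_nat[of c m k] unfolding c by (simp add: mult.commute)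
      moreover have "n div m = c" using pos c by simp
      moreover have "1 \<le> k * c" "k * c \<le> n" using k pos c by auto
      ultimately show "k * c \<in> ?A m" by simp
      show "k * c div c = k" using pos by simp
      show "?f (k * c) = [:- (cis (2 * pi / real m) ^ k), 1:]" by (simp only: pw)
    qed
  qed
  then have "(\<Prod>m\<in>{m. m dvd n}. cyclotomic_complex m) = (\<Prod>m\<in>{m. m dvd n}. prod ?f (?A m))"
    by (intro prod.cong) auto
  also have "\<dots> = prod ?f (\<Union>m\<in>{m. m dvd n}. ?A m)"
  proof (rule prod.UNION_disjoint[symmetric])
    show "\<forall>i\<in>{m. m dvd n}. \<forall>j\<in>{m. m dvd n}. i \<noteq> j \<longrightarrow> ?A i \<inter> ?A j = {}"
    proof (intro ballI impI)
      fix i j assume ij: "i \<in> {m. m dvd n}" "j \<in> {m. m dvd n}" "i \<noteq> j"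
      have "n div i \<noteq> n div j"
      proof
        assume eq: "n div i = n div j"
        have "i * (n div i) = j * (n div i)"
          using ij eq by (metis dvd_mult_div_cancel mem_Collect_eq)
        moreover have "n div i \<noteq> 0"
          using ij(1) assms by (metis dvd_mult_div_cancel mem_Collect_eq mult_0_right less_irrefl)
        ultimately show False using ij(3) by simp
      qed
      then show "?A i \<inter> ?A j = {}" by auto
    qed
  qed (use fin in auto)
  also have "(\<Union>m\<in>{m. m dvd n}. ?A m) = {1..n}"
  proof (intro equalityI subsetI)
    fix k assume k: "k \<in> {1..n}"
    have "n div gcd n k dvd n" "n div (n div gcd n k) = gcd n k"
    proof -
      obtain c where c: "n = gcd n k * c" using gcd_dvd1[of n k] by (elim dvdE)
      have g: "gcd n k > 0" and "c > 0" using assms c by (auto intro!: Nat.gr0I)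
      have "n div gcd n k = c" using c g by (metis nonzero_mult_div_cancel_left less_irrefl)
      moreover have "n div c = gcd n k" using c \<open>c > 0\<close>
        by (metis nonzero_mult_div_cancel_right less_irrefl)
      moreover have "c dvd n" using c by (metis dvd_triv_right)
      ultimately show "n div gcd n k dvd n" "n div (n div gcd n k) = gcd n k" by simp_all
    qed
    then show "k \<in> (\<Union>m\<in>{m. m dvd n}. ?A m)"
      using k by (intro UN_I[of "n div gcd n k"]) simp_all
  qed auto
  also have "prod ?f {1..n} = monom 1 n - 1"
    by (rule prod_roots_of_unity) fact
  finally show ?thesis .
qed

lemma cyclotomic_complex_rational: "\<exists>p. map_poly of_rat p = cyclotomic_complex n"
proof (induction n rule: less_induct)
  case (less n)
  show ?case
  proof (cases "n = 0")
    case True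
    then show ?thesis by (intro exI[of _ 1]) (simp add: cyclotomic_complex_def)
  next
    case False
    let ?S = "{m. m dvd n} - {n}"
    have S: "m < n" if "m \<in> ?S" for m
      using that False by (auto intro: le_neq_trans dvd_imp_le)
    define g where "g m = (SOME p. map_poly of_rat p = cyclotomic_complex m)" for m
    have g: "map_poly of_rat (g m) = cyclotomic_complex m" if "m \<in> ?S" for m
      unfolding g_def by (rule someI_ex) (rule less.IH[OF S[OF that]])
    define Q where "Q = prod g ?S"
    have Q: "map_poly of_rat Q = prod cyclotomic_complex ?S"
      unfolding Q_def map_poly_of_rat_prod by (intro prod.cong) (simp_all add: g)
    have Q0: "map_poly of_rat Q \<noteq> (0 :: complex poly)"
      unfolding Q using False by (simp add: cyclotomic_complex_def)
    define W :: "rat poly" where "W = monom 1 n - 1"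
    have W: "map_poly of_rat W = (monom 1 n - 1 :: complex poly)"
      by (intro poly_eqI) (simp add: W_def coeff_map_poly of_rat_diff)
    have prod: "map_poly of_rat W = cyclotomic_complex n * map_poly of_rat Q"
      unfolding W Q using prod_cyclotomic_complex[of n] False
        prod.remove[of "{m. m dvd n}" n cyclotomic_complex] by simp
    have "map_poly of_rat W = (map_poly of_rat (W div Q) * map_poly of_rat Q
            + map_poly of_rat (W mod Q) :: complex poly)"
      by (metis div_mult_mod_eq map_poly_of_rat_add map_poly_of_rat_mult)
    with prod have eq: "(cyclotomic_complex n - map_poly of_rat (W div Q)) * map_poly of_rat Q
        = map_poly of_rat (W mod Q)"
      by (simp add: algebra_simps)
    have "cyclotomic_complex n - map_poly of_rat (W div Q) = 0"
    proof (rule ccontr)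
      assume ne: "\<not> ?thesis"
      then have "degree (map_poly of_rat (W mod Q) :: complex poly) \<ge> degree Q"
        unfolding eq[symmetric] using Q0 by (simp add: degree_mult_eq degree_map_poly_of_rat)
      moreover have "W mod Q \<noteq> 0" using eq ne Q0 by auto
      moreover have "Q \<noteq> 0" using Q0 by auto
      ultimately show False
        using degree_mod_less'[of Q W] by (simp add: degree_map_poly_of_rat)
    qed
    then show ?thesis by auto
  qed
qed

lemma of_rat_cyclotomic: "map_poly of_rat (cyclotomic n) = cyclotomic_complex n"
  unfolding cyclotomic_def
  by (rule theI') (metis cyclotomic_complex_rational map_poly_of_rat_inj)

end

theory Submission
  imports Defs
begin

text \<open>
  Write \<open>p = 1/q\<close>, \<open>Q = q^d\<close> and \<open>M = ((d-1)n+1)/d\<close>. The summand is that of a very-well-poised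
  series in base \<open>Q\<close> whose \<open>2d\<close> numerator parameters all equal \<open>p\<close>. The idea is to deform each
  parameter \<open>p\<close> to \<open>p y\<close> (and its partner \<open>Q\<close> to \<open>Q / y\<close>), to find enough values of the \<open>y\<close> at
  which the truncated sum vanishes identically in \<open>q\<close>, and to divide by the corresponding linear
  factors: each of them becomes a multiple of \<open>\<Phi>_n\<close> when the deformation is undone. With
  \<open>y = u / v\<close> and denominators cleared, the deformed sum \<open>wp_sum\<close> is a polynomial in the \<open>u\<close> and \<open>v\<close>.

  There are two sources of zeros. If \<open>p = Q^{-M}\<close>, then \<open>k \<mapsto> M - k\<close> changes the sign of
  every term, whatever the \<open>y\<close> are (\<open>wp_sum_reflect_eq_0\<close>). As \<open>1/q\<close> and \<open>Q^{-M}\<close> agree modulo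
  \<open>\<Phi>_n\<close>, every integral deformation at \<open>p = 1/q\<close> is divisible by \<open>\<Phi>_n\<close>
  (\<open>wp_sum_qvar_in_loc_1\<close>). If instead one deformed parameter is \<open>Q^{-M}\<close> and the others come in pairs
  with \<open>p y y' = Q^{m+1}\<close>, then the terms are values of a polynomial in
  \<open>U_k = Q^{-k} + p Q^k\<close> divided by \<open>\<Prod>_{j \<noteq> k} (U_k - U_j)\<close>, so that the sum is a divided
  difference of order \<open>M\<close> and vanishes when that polynomial has degree below \<open>M\<close>
  (\<open>wp_sum_Karlsson_Minton_eq_0\<close>, a summation of Karlsson-Minton type due to Gasper).

  Take for the \<open>y\<close> the values \<open>1\<close>, \<open>x^{1-d}\<close>, \<open>x X^i\<close> and \<open>X^{-i}\<close> with \<open>1 \<le> i < d\<close>; this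
  is \<open>q_family\<close>. At \<open>x = q^n\<close> it vanishes for every \<open>X\<close>. At \<open>x = 1\<close> the \<open>y\<close> are \<open>1, 1, X^i, X^{-i}\<close>,
  which can be paired differently, and the sum vanishes at \<open>X = q^n\<close>; by the symmetry between \<open>X\<close>
  and \<open>1/X\<close> it also vanishes at \<open>X = q^{-n}\<close>. Now the factors \<open>\<Phi>_n\<close> are collected in turn
  (\<open>q_family_in_loc_4\<close>): one from the reflection, a second one from \<open>x - q^n\<close> at \<open>x = 1\<close>, and two
  more from \<open>(X - q^n)(X - q^{-n})\<close> at \<open>X = 1\<close>. To work with one variable at a time, the first
  step is carried out for positive integers \<open>x\<close> and \<open>X\<close>, and the second for positive integers \<open>X\<close>:
  if the values of a polynomial there are divisible by a power of \<open>\<Phi>_n\<close>, then so are its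
  coefficients (\<open>loc_poly_of_values\<close>).

  The terms with \<open>M < k < n\<close> are divisible by \<open>\<Phi>_n^{2d}\<close>, which settles the truncation at \<open>n - 1\<close>.
  For a divisor \<open>m\<close> of \<open>n\<close> with \<open>1 < m < n\<close> a single factor \<open>\<Phi>_m\<close> is needed: modulo \<open>\<Phi>_m\<close>
  each block of \<open>m\<close> consecutive terms is a multiple of the first block, and the latter vanishes by
  the reflection (\<open>q_summand_sum_in_loc_1\<close>). Since \<open>[n]\<close> is the product of the \<open>\<Phi>_m\<close> over the
  divisors \<open>m > 1\<close> of \<open>n\<close> and these are pairwise coprime, the divisibilities combine.
\<close>

section \<open>Very-well-poised sums with cleared denominators\<close>

text \<open>The sum is the coefficient of degree \<open>M\<close> in the Lagrange interpolation polynomial of \<open>g\<close> at the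
  nodes \<open>U k\<close>, and that polynomial is \<open>g\<close> itself.\<close>

lemma sum_divided_by_node_differences_eq_0:
  fixes U :: "nat \<Rightarrow> 'a::field"
  assumes inj: "inj_on U {..M}" and deg: "degree g < M"
  shows "(\<Sum>k\<le>M. poly g (U k) / (\<Prod>j\<in>{..M} - {k}. U k - U j)) = 0"
proof -
  define c where "c k = poly g (U k) / (\<Prod>j\<in>{..M} - {k}. U k - U j)" for k
  define B where "B k = (\<Prod>j\<in>{..M} - {k}. [:- U j, 1:])" for k
  define L where "L = (\<Sum>k\<le>M. smult (c k) (B k))"
  have degB: "degree (B k) = M" if "k \<le> M" for k
    using that unfolding B_def by (subst degree_prod_eq_sum_degree) auto
  have coeffB: "coeff (B k) M = 1" if "k \<le> M" for k
  proof -
    have "lead_coeff (B k) = 1"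
      unfolding B_def by (subst lead_coeff_prod) simp
    then show ?thesis using degB[OF that] by simp
  qed
  have "poly L (U i) = poly g (U i)" if i: "i \<le> M" for i
  proof -
    have "poly L (U i) = (\<Sum>k\<le>M. c k * (\<Prod>j\<in>{..M} - {k}. U i - U j))"
      by (simp add: L_def B_def poly_sum poly_prod)
    also have "\<dots> = (\<Sum>k\<in>{i}. c k * (\<Prod>j\<in>{..M} - {k}. U i - U j))"
      using i by (intro sum.mono_neutral_right) (auto intro!: prod_zero)
    also have "\<dots> = poly g (U i)"
    proof -
      have "(\<Prod>j\<in>{..M} - {i}. U i - U j) \<noteq> 0"
        using i inj by (auto simp: inj_on_def)
      then show ?thesis by (simp add: c_def)
    qed
    finally show ?thesis .
  qed
  then have roots: "U ` {..M} \<subseteq> {x. poly (L - g) x = 0}" by auto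
  have "L - g = 0"
  proof (rule ccontr)
    assume ne: "L - g \<noteq> 0"
    have "degree L \<le> M"
      unfolding L_def using degB by (intro degree_sum_le) (auto intro: order.trans[OF degree_smult_le])
    then have "degree (L - g) \<le> M" using deg by (intro degree_diff_le) auto
    moreover have "card (U ` {..M}) \<le> card {x. poly (L - g) x = 0}"
      using roots poly_roots_finite[OF ne] by (rule card_mono[rotated])
    moreover have "card (U ` {..M}) = Suc M" using inj by (simp add: card_image)
    ultimately show False using card_poly_roots_bound[OF ne] by linarith
  qed
  then have "coeff L M = 0" using deg by (simp add: coeff_eq_0)
  then show ?thesis using coeffB by (simp add: L_def coeff_sum c_def)
qed

text \<open>For \<open>y = u / v\<close> this is, up to a factor that does not depend on \<open>k\<close>, the quotient of \<open>(p y; Q)_k\<close>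
  by \<open>(Q / y; Q)_k y^k\<close>, the contribution of one parameter of a very-well-poised series. All \<open>M\<close>
  factors are kept for every \<open>k\<close> so that numerators and denominators are cleared uniformly, and
  \<open>u, v\<close> are homogeneous coordinates so that the parameters may involve negative powers.\<close>

definition wp_factor :: "'a::field \<Rightarrow> 'a \<Rightarrow> nat \<Rightarrow> nat \<Rightarrow> 'a \<Rightarrow> 'a \<Rightarrow> 'a" where
  "wp_factor p Q M k u v = (\<Prod>j<M. if j < k then v - p * Q ^ j * u else u - Q ^ Suc j * v)"

text \<open>The argument of the series is distributed over pairs of parameters: with \<open>d\<close> pairs the total
  power is \<open>(Q / p)^{d k}\<close>. With this normalisation a pair is invariant under the reflection below, and
  a suitable pair is exactly a polynomial in \<open>Q^{-k} + p Q^k\<close>.\<close>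

definition wp_pair :: "'a::field \<Rightarrow> 'a \<Rightarrow> nat \<Rightarrow> nat \<Rightarrow> 'a \<Rightarrow> 'a \<Rightarrow> 'a \<Rightarrow> 'a \<Rightarrow> 'a" where
  "wp_pair p Q M k u v u' v' = (Q / p) ^ k * wp_factor p Q M k u v * wp_factor p Q M k u' v'"

text \<open>The first pair contains the parameter \<open>p\<close> itself, that is \<open>y = 1\<close>, whose partner produces
  \<open>(Q; Q)_k\<close> in the denominator. The remaining factor is the very-well-poised
  part \<open>1 - p Q^{2k}\<close> times \<open>Q^{-k}\<close>, which makes it odd under the reflection.\<close>

definition wp_sum :: "'a::field \<Rightarrow> 'a \<Rightarrow> nat \<Rightarrow> 'a \<Rightarrow> 'a \<Rightarrow> 'i set \<Rightarrow>
    ('i \<Rightarrow> 'a) \<Rightarrow> ('i \<Rightarrow> 'a) \<Rightarrow> ('i \<Rightarrow> 'a) \<Rightarrow> ('i \<Rightarrow> 'a) \<Rightarrow> 'a" where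
  "wp_sum p Q M u0 v0 I u v u' v' =
     (\<Sum>k\<le>M. (inverse Q ^ k - p * Q ^ k) * wp_pair p Q M k 1 1 u0 v0 *
        (\<Prod>i\<in>I. wp_pair p Q M k (u i) (v i) (u' i) (v' i)))"

lemma wp_factor_scale: "wp_factor p Q M k (c * u) (c * v) = c ^ M * wp_factor p Q M k u v"
proof -
  have "wp_factor p Q M k (c * u) (c * v) = (\<Prod>j<M. c * (if j < k then v - p * Q ^ j * u else u - Q ^ Suc j * v))"
    unfolding wp_factor_def by (rule prod.cong) (auto simp: algebra_simps)
  then show ?thesis by (simp only: prod.distrib prod_constant card_lessThan wp_factor_def)
qed

lemma wp_factor_split:
  assumes "k \<le> M"
  shows "wp_factor p Q M k u v = (\<Prod>j<k. v - p * Q ^ j * u) * (\<Prod>j=k..<M. u - Q ^ Suc j * v)"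
proof -
  have *: "{..<M} = {..<k} \<union> {k..<M}" using assms by auto
  show ?thesis
    unfolding wp_factor_def * by (subst prod.union_disjoint) auto
qed

text \<open>For \<open>p = Q^{-M}\<close> the two kinds of factors are exchanged by \<open>j \<mapsto> M - 1 - j\<close> up to powers of \<open>Q\<close>:
  \<open>Q^{j+1} (v - p Q^{M-1-j} u) = - (u - Q^{j+1} v)\<close>.\<close>

lemma wp_factor_reflect:
  assumes p: "p * Q ^ M = 1" and k: "k \<le> M"
  shows "(\<Prod>j<M. Q ^ Suc j) * wp_factor p Q M (M - k) u v = (- 1) ^ M * Q ^ (k * Suc M) * wp_factor p Q M k u v"
proof -
  have "wp_factor p Q M (M - k) u v = (\<Prod>j<M. if M - Suc j < M - k then v - p * Q ^ (M - Suc j) * u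
          else u - Q ^ Suc (M - Suc j) * v)"
    unfolding wp_factor_def by (subst prod.nat_diff_reindex[symmetric]) simp
  then have "(\<Prod>j<M. Q ^ Suc j) * wp_factor p Q M (M - k) u v =
     (\<Prod>j<M. Q ^ Suc j * (if M - Suc j < M - k then v - p * Q ^ (M - Suc j) * u
          else u - Q ^ Suc (M - Suc j) * v))"
    by (simp add: prod.distrib)
  also have "\<dots> = (\<Prod>j<M. (if j < k then - (Q ^ Suc M) else - 1) *
      (if j < k then v - p * Q ^ j * u else u - Q ^ Suc j * v))"
  proof (rule prod.cong)
    fix j assume "j \<in> {..<M}"
    then have j: "j < M" by simp
    then have e: "Q ^ Suc j * Q ^ (M - Suc j) = Q ^ M" "Q ^ Suc (M - Suc j) * Q ^ j = Q ^ M"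
      by (simp_all flip: power_add power_Suc)
    show "Q ^ Suc j * (if M - Suc j < M - k then v - p * Q ^ (M - Suc j) * u
          else u - Q ^ Suc (M - Suc j) * v) =
       (if j < k then - (Q ^ Suc M) else - 1) *
      (if j < k then v - p * Q ^ j * u else u - Q ^ Suc j * v)"
    proof (cases "j < k")
      case True
      then have "\<not> M - Suc j < M - k" using j k by auto
      moreover have "Q ^ Suc j * (u - Q ^ Suc (M - Suc j) * v) = - (Q ^ Suc M) * (v - p * Q ^ j * u)"
      proof -
        have "Q ^ Suc j * (u - Q ^ Suc (M - Suc j) * v) = Q ^ Suc j * u - Q * (Q ^ Suc (M - Suc j) * Q ^ j) * v"
          by (simp add: algebra_simps)
        also have "\<dots> = Q ^ Suc j * u * (p * Q ^ M) - Q * Q ^ M * v" by (simp only: e p) simp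
        also have "\<dots> = - (Q ^ Suc M) * (v - p * Q ^ j * u)" by (simp add: algebra_simps)
        finally show ?thesis .
      qed
      ultimately show ?thesis using True by simp
    next
      case False
      then have "M - Suc j < M - k" using j k by auto
      moreover have "Q ^ Suc j * (v - p * Q ^ (M - Suc j) * u) = - 1 * (u - Q ^ Suc j * v)"
      proof -
        have "Q ^ Suc j * (v - p * Q ^ (M - Suc j) * u) = Q ^ Suc j * v - p * (Q ^ Suc j * Q ^ (M - Suc j)) * u"
          by (simp add: algebra_simps)
        then show ?thesis by (simp only: e p) simp
      qed
      ultimately show ?thesis using False by simp
    qed
  qed simp
  also have "\<dots> = (\<Prod>j<M. if j < k then - (Q ^ Suc M) else - 1) * wp_factor p Q M k u v"
    by (simp add: prod.distrib wp_factor_def)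
  also have "(\<Prod>j<M. if j < k then - (Q ^ Suc M) else (- 1::'a)) = (\<Prod>j<M. - 1) * (\<Prod>j<M. if j < k then Q ^ Suc M else 1)"
    by (subst prod.distrib[symmetric]) (rule prod.cong, auto)
  also have "(\<Prod>j<M. if j < k then Q ^ Suc M else 1) = (\<Prod>j<k. Q ^ Suc M)"
    using k by (subst prod.If_cases) (auto simp: Int_absorb1 lessThan_def[symmetric] intro!: arg_cong[of _ _ "\<lambda>A. _ ^ card A"])
  also have "(\<Prod>j<k. Q ^ Suc M) = Q ^ (k * Suc M)" by (simp only: prod_constant card_lessThan power_mult[symmetric] mult.commute)
  finally show ?thesis by simp
qed

lemma wp_pair_reflect:
  assumes p: "p * Q ^ M = 1" and k: "k \<le> M"
  shows "wp_pair p Q M (M - k) u v u' v' = wp_pair p Q M k u v u' v'"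
proof -
  let ?c = "\<Prod>j<M. Q ^ Suc j"
  have p0: "p \<noteq> 0" using p by auto
  have Q0: "Q = 0 \<Longrightarrow> M = 0" using p by (cases M) auto
  have c0: "?c \<noteq> 0" using Q0 by auto
  have Qp: "(Q / p) ^ l = Q ^ (l * Suc M)" for l
  proof -
    have "Q / p = Q ^ Suc M" using p p0 by (simp add: field_simps)
    then show ?thesis by (simp only: power_mult[symmetric] mult.commute)
  qed
  have kk: "M - (M - k) = k" using k by simp
  have "?c * wp_pair p Q M (M - k) u v u' v' =
      Q ^ ((M - k) * Suc M) * wp_factor p Q M (M - k) u' v' * (?c * wp_factor p Q M (M - k) u v)"
    by (simp add: wp_pair_def Qp algebra_simps)
  also have "\<dots> = Q ^ (k * Suc M) * wp_factor p Q M k u v * ((-1) ^ M * Q ^ ((M - k) * Suc M) * wp_factor p Q M (M - k) u' v')"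
    by (subst wp_factor_reflect[OF p k]) (simp add: algebra_simps)
  also have "(-1) ^ M * Q ^ ((M - k) * Suc M) * wp_factor p Q M (M - k) u' v' = ?c * wp_factor p Q M k u' v'"
    using wp_factor_reflect[OF p, of "M - k" u' v'] kk by simp
  finally have "?c * wp_pair p Q M (M - k) u v u' v' = ?c * wp_pair p Q M k u v u' v'"
    by (simp add: wp_pair_def Qp algebra_simps)
  then show ?thesis using c0 by simp
qed

text \<open>Every pair is invariant under \<open>k \<mapsto> M - k\<close>, and \<open>Q^{-k} - p Q^k\<close> changes its sign.\<close>

lemma wp_sum_reflect_eq_0:
  fixes p Q :: "'a::field"
  assumes p: "p * Q ^ M = 1" and Q: "Q \<noteq> 0" and two: "(2::'a) \<noteq> 0"
  shows "wp_sum p Q M u0 v0 I u v u' v' = 0"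
proof -
  let ?t = "\<lambda>k. (inverse Q ^ k - p * Q ^ k) * wp_pair p Q M k 1 1 u0 v0 *
        (\<Prod>i\<in>I. wp_pair p Q M k (u i) (v i) (u' i) (v' i))"
  have "?t (M - k) = - ?t k" if k: "k \<le> M" for k
  proof -
    have pk: "p * Q ^ (M - k) = inverse Q ^ k"
    proof -
      have "p * Q ^ (M - k) * Q ^ k = 1" using p k by (simp flip: power_add mult.assoc add: mult.assoc)
      then show ?thesis using Q by (simp add: field_simps)
    qed
    have "p * Q ^ k = inverse Q ^ (M - k)"
    proof -
      have "p * Q ^ k * Q ^ (M - k) = 1" using p k by (simp flip: power_add mult.assoc add: mult.assoc)
      then show ?thesis using Q by (simp add: field_simps)
    qed
    then show ?thesis using pk by (simp add: wp_pair_reflect[OF p k] algebra_simps)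
  qed
  then have "(\<Sum>k\<le>M. ?t (M - k)) = - (\<Sum>k\<le>M. ?t k)"
    by (simp add: sum_negf[symmetric])
  moreover have "(\<Sum>k\<le>M. ?t (M - k)) = (\<Sum>k\<le>M. ?t k)"
    by (rule sum.reindex_bij_witness[of _ "\<lambda>k. M - k" "\<lambda>k. M - k"]) auto
  ultimately have "2 * (\<Sum>k\<le>M. ?t k) = 0" by simp
  then show ?thesis using two by (simp add: wp_sum_def)
qed

text \<open>Both sides multiply \<open>f\<close> over the same multiset of indices.\<close>

lemma prod_shift_exchange:
  fixes f :: "nat \<Rightarrow> 'a::comm_monoid_mult"
  assumes "k \<le> M" "m \<le> M"
  shows "(\<Prod>j<k. f (m + j)) * (\<Prod>j=k..<M. f j) = (\<Prod>j<m. f (k + j)) * (\<Prod>j=m..<M. f j)"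
proof -
  have shift: "(\<Prod>j<b. f (a + j)) = prod f {a..<a + b}" for a b
    using prod.shift_bounds_nat_ivl[of f 0 a b] by (simp add: add.commute atLeast0LessThan)
  show ?thesis
  proof (cases "k \<le> m")
    case True
    then have *: "prod f {k..<M} = prod f {k..<m} * prod f {m..<M}"
      "prod f {k..<k + m} = prod f {k..<m} * prod f {m..<k + m}"
      using assms by (simp_all add: prod.atLeastLessThan_concat)
    show ?thesis unfolding shift * add.commute[of m k] by (simp only: mult_ac)
  next
    case False
    then have *: "prod f {m..<M} = prod f {m..<k} * prod f {k..<M}"
      "prod f {m..<k + m} = prod f {m..<k} * prod f {k..<k + m}"
      using assms by (simp_all add: prod.atLeastLessThan_concat)
    show ?thesis unfolding shift * add.commute[of m k] by (simp only: mult_ac)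
  qed
qed

text \<open>The relation between the parameters turns the numerator factors of the one into shifted
  denominator factors of the other, so that for each parameter all but \<open>m\<close> factors do not depend
  on \<open>k\<close>. The remaining ones are multiplied crosswise, the \<open>t\<close>-th factor of the first parameter
  with the \<open>(m-1-t)\<close>-th of the second: each product is \<open>Q^k\<close> times a linear
  polynomial in \<open>Q^{-k} + p Q^k\<close>.\<close>

lemma wp_pair_polynomial:
  assumes nz: "p \<noteq> 0" "Q \<noteq> 0" "u \<noteq> 0" "u' \<noteq> 0"
    and rel: "p * u * u' = Q ^ Suc m * v * v'" and m: "m \<le> M"
  obtains g where "degree g \<le> m"
    "\<And>k. k \<le> M \<Longrightarrow> wp_pair p Q M k u v u' v' = poly g (inverse Q ^ k + p * Q ^ k)"
proof -
  define f where "f u v j = u - Q ^ Suc j * v" for u v :: 'a and j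
  define c where "c t = Q ^ Suc t * v * u' + Q ^ (m - t) * u * v'" for t
  define K where "K = (\<Prod>j=m..<M. f u v j) * (\<Prod>j=m..<M. f u' v' j)"
  define g where "g = smult K (\<Prod>t<m. [:- c t, u * u':])"
  have "degree g \<le> (\<Sum>t<m. degree [:- c t, u * u':])"
    using order.trans[OF degree_smult_le degree_prod_sum_le[OF finite_lessThan]]
    unfolding g_def o_def .
  also have "\<dots> \<le> (\<Sum>t<m. 1)"
    by (rule sum_mono) simp
  finally have "degree g \<le> m" by simp
  moreover have "wp_pair p Q M k u v u' v' = poly g (inverse Q ^ k + p * Q ^ k)" if k: "k \<le> M" for k
  proof -
    define U where "U = inverse Q ^ k + p * Q ^ k"
    have wt1: "wp_factor p Q M k u v = (v / u') ^ k * (\<Prod>j<k. f u' v' (m + j)) * (\<Prod>j=k..<M. f u v j)"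
      if rel: "p * u * u' = Q ^ Suc m * v * v'" and nz: "u' \<noteq> 0" for u v u' v' :: 'a
    proof -
      have "v - p * Q ^ j * u = v / u' * f u' v' (m + j)" for j
      proof -
        have "u' * (v - p * Q ^ j * u) = v * u' - Q ^ j * (p * u * u')" by (simp add: algebra_simps)
        also have "\<dots> = v * f u' v' (m + j)"
          unfolding rel f_def by (simp add: algebra_simps power_add)
        finally show ?thesis using nz by (simp add: field_simps)
      qed
      then have "(\<Prod>j<k. v - p * Q ^ j * u) = (v / u') ^ k * (\<Prod>j<k. f u' v' (m + j))"
        by (simp only: prod.distrib prod_constant card_lessThan)
      then show ?thesis unfolding wp_factor_split[OF k] f_def by simp
    qed
    have rel': "p * u' * u = Q ^ Suc m * v' * v" using rel by (simp add: mult_ac)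
    have ratio: "Q / p * (v / u') * (v' / u) = inverse Q ^ m"
    proof -
      have "inverse Q ^ m * Q ^ m = 1" using nz by (simp add: power_inverse)
      moreover have "p * u * u' * inverse Q ^ m = (inverse Q ^ m * Q ^ m) * (Q * v * v')"
        unfolding rel by (simp add: mult_ac)
      ultimately have "Q * v * v' = p * u * u' * inverse Q ^ m" by simp
      then have "Q * v * v' / (p * u * u') = inverse Q ^ m" using nz by simp
      then show ?thesis by (simp add: mult_ac)
    qed
    have "wp_pair p Q M k u v u' v' = (Q / p * (v / u') * (v' / u)) ^ k *
        ((\<Prod>j<k. f u v (m + j)) * (\<Prod>j=k..<M. f u v j)) *
        ((\<Prod>j<k. f u' v' (m + j)) * (\<Prod>j=k..<M. f u' v' j))"
      unfolding wp_pair_def wt1[OF rel nz(4)] wt1[OF rel' nz(3)]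
      by (simp only: power_mult_distrib mult_ac)
    also have "\<dots> = (inverse Q ^ m) ^ k * K * ((\<Prod>t<m. f u v (k + t)) * (\<Prod>t<m. f u' v' (k + t)))"
      unfolding ratio prod_shift_exchange[OF k m] K_def by (simp only: mult_ac)
    also have "(\<Prod>t<m. f u' v' (k + t)) = (\<Prod>t<m. f u' v' (k + (m - Suc t)))"
      by (subst prod.nat_diff_reindex[symmetric]) simp
    also have "(\<Prod>t<m. f u v (k + t)) * \<dots> = (\<Prod>t<m. Q ^ k * (u * u' * U - c t))"
      unfolding prod.distrib[symmetric]
    proof (rule prod.cong)
      fix t assume "t \<in> {..<m}"
      then have t: "t < m" by simp
      then have e: "Suc (k + (m - Suc t)) = k + (m - t)" by simp
      have e2: "Q ^ (m - t) * Q ^ t = Q ^ m" using t by (simp flip: power_add)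
      have e3: "Q ^ k * U = 1 + p * Q ^ k * Q ^ k"
        using nz unfolding U_def by (simp add: distrib_left power_inverse mult_ac)
      have "f u v (k + t) * f u' v' (k + (m - Suc t)) =
          u * u' - Q ^ k * c t + Q ^ k * Q ^ k * (Q * (Q ^ (m - t) * Q ^ t) * v * v')"
        unfolding f_def e c_def by (simp add: algebra_simps power_add)
      also have "Q * (Q ^ (m - t) * Q ^ t) * v * v' = p * u * u'"
        unfolding e2 using rel by simp
      also have "u * u' - Q ^ k * c t + Q ^ k * Q ^ k * (p * u * u') = u * u' * (Q ^ k * U) - Q ^ k * c t"
        unfolding e3 by (simp add: algebra_simps)
      finally show "f u v (k + t) * f u' v' (k + (m - Suc t)) = Q ^ k * (u * u' * U - c t)"
        by (simp add: algebra_simps)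
    qed simp
    also have "\<dots> = (Q ^ m) ^ k * (\<Prod>t<m. u * u' * U - c t)"
      by (simp add: prod.distrib power_mult[symmetric] mult.commute)
    also have "(inverse Q ^ m) ^ k * K * ((Q ^ m) ^ k * (\<Prod>t<m. u * u' * U - c t)) =
        K * (\<Prod>t<m. u * u' * U - c t)"
      using nz by (simp add: power_inverse)
    also have "\<dots> = poly g U"
      by (simp add: g_def poly_prod algebra_simps)
    finally show ?thesis unfolding U_def .
  qed
  ultimately show thesis by (rule that)
qed

text \<open>The nodes satisfy \<open>U k - U j = (Q^{-k} - Q^{-j}) (1 - p Q^{k+j})\<close>. The products of the first factors
  and of the second factors over \<open>j \<noteq> k\<close> complete the \<open>Q\<close>-shifted factorials in the remaining
  part of the term to products over ranges that do not depend on \<open>k\<close>.\<close>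

lemma wp_pair_node_differences:
  fixes p Q :: "'a::field"
  assumes nz: "p \<noteq> 0" "Q \<noteq> 0"
  defines "U \<equiv> \<lambda>k. inverse Q ^ k + p * Q ^ k"
  obtains K where "\<And>k. k \<le> M \<Longrightarrow> (inverse Q ^ k - p * Q ^ k) * wp_pair p Q M k 1 1 u0 (p * Q ^ M * u0) *
      (\<Prod>j\<in>{..M} - {k}. U k - U j) = K"
proof -
  define r where "r = inverse Q"
  have rQ: "r ^ i * Q ^ i = 1" for i
    using nz by (simp add: r_def power_inverse)
  have rQ': "r ^ i * Q ^ j = r ^ (i - j)" if "j \<le> i" for i j
  proof -
    have "r ^ i = r ^ (i - j) * r ^ j" using that by (simp flip: power_add)
    then show ?thesis using rQ[of j] by (simp add: mult.assoc)
  qed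
  have rQ'': "r ^ i * Q ^ j = Q ^ (j - i)" if "i \<le> j" for i j
  proof -
    have "Q ^ j = Q ^ i * Q ^ (j - i)" using that by (simp flip: power_add)
    then show ?thesis using rQ[of i] by (metis mult.assoc mult.left_neutral)
  qed
  \<comment> \<open>The three kinds of factors into which the term and the node differences decompose.\<close>
  define h where "h j = 1 - p * Q ^ j" for j
  define F where "F j = 1 - Q ^ Suc j" for j
  define G where "G j = Q ^ Suc j - 1" for j
  define K where "K = u0 ^ M * prod h {..<Suc (2 * M)} * prod F {..<M} * prod G {..<M} * (\<Prod>j<M. r ^ Suc j)"
  have "(r ^ k - p * Q ^ k) * wp_pair p Q M k 1 1 u0 (p * Q ^ M * u0) *
      (\<Prod>j\<in>{..M} - {k}. U k - U j) = K" if k: "k \<le> M" for k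
  proof -
    have a: "wp_factor p Q M k 1 1 = prod h {..<k} * prod F {k..<M}"
      unfolding wp_factor_split[OF k] h_def F_def by simp
    have b: "wp_factor p Q M k u0 (p * Q ^ M * u0) =
        u0 ^ M * p ^ k * (\<Prod>j<k. Q ^ M - Q ^ j) * (\<Prod>j=k..<M. h (Suc j + M))"
    proof -
      have "(\<Prod>j<k. p * Q ^ M * u0 - p * Q ^ j * u0) = (\<Prod>j<k. (p * u0) * (Q ^ M - Q ^ j))"
        by (intro prod.cong) (auto simp: algebra_simps)
      moreover have "(\<Prod>j=k..<M. u0 - Q ^ Suc j * (p * Q ^ M * u0)) = (\<Prod>j=k..<M. u0 * h (Suc j + M))"
        by (intro prod.cong) (auto simp: h_def algebra_simps power_add)
      moreover have "u0 ^ M = u0 ^ k * u0 ^ (M - k)" using k by (simp flip: power_add)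
      ultimately show ?thesis
        unfolding wp_factor_split[OF k] by (simp add: prod.distrib power_mult_distrib mult_ac)
    qed
    have c: "(\<Prod>j\<in>{..M} - {k}. U k - U j) =
        (\<Prod>j\<in>{..M} - {k}. r ^ k - r ^ j) * (\<Prod>j\<in>{..M} - {k}. h (k + j))"
      unfolding prod.distrib[symmetric]
    proof (rule prod.cong)
      fix j
      have "(r ^ k - r ^ j) * h (k + j) = r ^ k - r ^ j - p * ((r ^ k * Q ^ k) * Q ^ j) + p * ((r ^ j * Q ^ j) * Q ^ k)"
        unfolding h_def by (simp add: algebra_simps power_add)
      then show "U k - U j = (r ^ k - r ^ j) * h (k + j)"
        unfolding rQ U_def r_def[symmetric] by (simp add: algebra_simps)
    qed simp
    have d: "(r ^ k - p * Q ^ k) * (\<Prod>j\<in>{..M} - {k}. h (k + j)) = r ^ k * (\<Prod>j\<le>M. h (k + j))"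
    proof -
      have "r ^ k - p * Q ^ k = r ^ k * h (k + k)"
        using rQ[of k] unfolding h_def by (simp add: algebra_simps power_add)
      moreover have "(\<Prod>j\<le>M. h (k + j)) = h (k + k) * (\<Prod>j\<in>{..M} - {k}. h (k + j))"
        using k by (subst prod.remove[of _ k]) auto
      ultimately show ?thesis by (simp add: mult.assoc)
    qed
    have e: "prod h {..<k} * (\<Prod>j\<le>M. h (k + j)) * (\<Prod>j=k..<M. h (Suc j + M)) = prod h {..<Suc (2 * M)}"
    proof -
      have "(\<Prod>j\<le>M. h (k + j)) = prod h {k..<Suc M + k}"
        using prod.shift_bounds_nat_ivl[of h 0 k "Suc M"]
        by (simp add: add.commute atLeast0LessThan lessThan_Suc_atMost)
      moreover have "(\<Prod>j=k..<M. h (Suc j + M)) = prod h {k + Suc M..<M + Suc M}"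
        using prod.shift_bounds_nat_ivl[of h k "Suc M" M] by simp
      moreover have "prod h {0..<k} * prod h {k..<Suc M + k} = prod h {0..<Suc M + k}"
        by (rule prod.atLeastLessThan_concat) auto
      moreover have "prod h {0..<Suc M + k} * prod h {Suc M + k..<M + Suc M} = prod h {0..<M + Suc M}"
        using k by (intro prod.atLeastLessThan_concat) auto
      moreover have "M + Suc M = Suc (2 * M)" "k + Suc M = Suc M + k" by simp_all
      ultimately show ?thesis unfolding atLeast0LessThan by (simp only:)
    qed
    have f: "(\<Prod>j\<in>{..M} - {k}. r ^ k - r ^ j) = (\<Prod>j<k. r ^ k - r ^ j) * (\<Prod>j=k..<M. r ^ k - r ^ Suc j)"
    proof -
      have *: "{..M} - {k} = {..<k} \<union> {Suc k..<Suc M}" using k by auto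
      have "(\<Prod>j\<in>{..M} - {k}. r ^ k - r ^ j) = (\<Prod>j<k. r ^ k - r ^ j) * (\<Prod>j=Suc k..<Suc M. r ^ k - r ^ j)"
        unfolding * by (rule prod.union_disjoint) auto
      then show ?thesis by (simp only: prod.shift_bounds_Suc_ivl)
    qed
    have g: "(\<Prod>j<k. r ^ k - r ^ j) = (\<Prod>j<k. r ^ k) * prod F {..<k}"
    proof -
      have "(\<Prod>j<k. r ^ k - r ^ j) = (\<Prod>j<k. r ^ k * F (k - Suc j))"
      proof (rule prod.cong)
        fix j assume "j \<in> {..<k}"
        then have "r ^ k * Q ^ Suc (k - Suc j) = r ^ j"
          by (subst rQ') auto
        then show "r ^ k - r ^ j = r ^ k * F (k - Suc j)"
          unfolding F_def by (simp only: right_diff_distrib mult_1_right)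
      qed simp
      then show ?thesis by (simp only: prod.distrib prod.nat_diff_reindex)
    qed
    have h1: "(\<Prod>j=k..<M. r ^ k - r ^ Suc j) = (\<Prod>j=k..<M. r ^ Suc j) * prod G {..<M - k}"
    proof -
      have "(\<Prod>j=k..<M. r ^ k - r ^ Suc j) = (\<Prod>j=k..<M. r ^ Suc j * G (j - k))"
      proof (rule prod.cong)
        fix j assume "j \<in> {k..<M}"
        then have "r ^ Suc j * Q ^ Suc (j - k) = r ^ k"
          by (subst rQ') auto
        then show "r ^ k - r ^ Suc j = r ^ Suc j * G (j - k)"
          unfolding G_def by (simp only: right_diff_distrib mult_1_right)
      qed simp
      moreover have "(\<Prod>j=k..<M. G (j - k)) = prod G {..<M - k}"
        by (rule prod.reindex_bij_witness[of _ "\<lambda>j. j + k" "\<lambda>j. j - k"]) auto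
      ultimately show ?thesis by (simp only: prod.distrib)
    qed
    have h2: "(\<Prod>j<k. Q ^ M - Q ^ j) = (\<Prod>j<k. Q ^ j) * prod G {M - k..<M}"
    proof -
      have "(\<Prod>j<k. Q ^ M - Q ^ j) = (\<Prod>j<k. Q ^ j * G (M - Suc j))"
      proof (rule prod.cong)
        fix j assume "j \<in> {..<k}"
        then have "Q ^ j * Q ^ Suc (M - Suc j) = Q ^ M"
          using k by (subst power_add[symmetric]) auto
        then show "Q ^ M - Q ^ j = Q ^ j * G (M - Suc j)"
          unfolding G_def by (simp only: right_diff_distrib mult_1_right)
      qed simp
      moreover have "(\<Prod>j<k. G (M - Suc j)) = prod G {M - k..<M}"
        using k by (intro prod.reindex_bij_witness[of _ "\<lambda>j. M - Suc j" "\<lambda>j. M - Suc j"]) auto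
      ultimately show ?thesis by (simp only: prod.distrib)
    qed
    have i: "(\<Prod>j<k. r ^ k) * (\<Prod>j<k. Q ^ j) * (\<Prod>j=k..<M. r ^ Suc j) = (\<Prod>j<M. r ^ Suc j)"
    proof -
      have "(\<Prod>j<k. r ^ k) * (\<Prod>j<k. Q ^ j) = (\<Prod>j<k. r ^ Suc (k - Suc j))"
        unfolding prod.distrib[symmetric]
      proof (rule prod.cong)
        fix j assume j: "j \<in> {..<k}"
        then have "r ^ k * Q ^ j = r ^ (k - j)" by (subst rQ') auto
        then show "r ^ k * Q ^ j = r ^ Suc (k - Suc j)" using j by (simp add: Suc_diff_Suc)
      qed simp
      also have "\<dots> = (\<Prod>j<k. r ^ Suc j)"
        by (rule prod.nat_diff_reindex[of "\<lambda>j. r ^ Suc j"])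
      finally show ?thesis
        using k prod.atLeastLessThan_concat[of 0 k M "\<lambda>j. r ^ Suc j"] by (simp add: atLeast0LessThan)
    qed
    have jF: "prod F {..<k} * prod F {k..<M} = prod F {..<M}"
      using k prod.atLeastLessThan_concat[of 0 k M F] by (simp add: atLeast0LessThan)
    have jG: "prod G {..<M - k} * prod G {M - k..<M} = prod G {..<M}"
      using k prod.atLeastLessThan_concat[of 0 "M - k" M G] by (simp add: atLeast0LessThan)
    have rp: "r ^ k * (Q / p) ^ k * p ^ k = 1"
    proof -
      have "r * (Q / p) * p = 1" using nz by (simp add: r_def)
      then show ?thesis by (simp only: power_mult_distrib[symmetric] power_one)
    qed
    have "(r ^ k - p * Q ^ k) * wp_pair p Q M k 1 1 u0 (p * Q ^ M * u0) *
        (\<Prod>j\<in>{..M} - {k}. U k - U j) =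
      ((r ^ k - p * Q ^ k) * (\<Prod>j\<in>{..M} - {k}. h (k + j))) * ((Q / p) ^ k * p ^ k) * u0 ^ M *
        (prod h {..<k} * (\<Prod>j=k..<M. h (Suc j + M))) * prod F {k..<M} *
        (\<Prod>j<k. Q ^ M - Q ^ j) * (\<Prod>j\<in>{..M} - {k}. r ^ k - r ^ j)"
      unfolding wp_pair_def a b c by (simp only: mult_ac)
    also have "\<dots> = (r ^ k * (Q / p) ^ k * p ^ k) * u0 ^ M *
       (prod h {..<k} * (\<Prod>j\<le>M. h (k + j)) * (\<Prod>j=k..<M. h (Suc j + M))) *
       (prod F {..<k} * prod F {k..<M}) * (prod G {..<M - k} * prod G {M - k..<M}) *
       ((\<Prod>j<k. r ^ k) * (\<Prod>j<k. Q ^ j) * (\<Prod>j=k..<M. r ^ Suc j))"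
      unfolding d f g h1 h2 by (simp only: mult_ac)
    also have "\<dots> = K"
      unfolding rp e jF jG i K_def by (simp only: mult_ac mult_1_left mult_1_right)
    finally show ?thesis .
  qed
  then show thesis using that unfolding r_def by blast
qed

text \<open>A summation of Karlsson-Minton type, due to Gasper. It holds because the sum is a divided
  difference of order \<open>M\<close> of a polynomial of degree at most \<open>card I * m < M\<close>.\<close>

lemma wp_sum_Karlsson_Minton_eq_0:
  fixes p Q :: "'a::field"
  assumes nz: "p \<noteq> 0" "Q \<noteq> 0"
    and Q1: "\<And>k. 0 < k \<Longrightarrow> Q ^ k \<noteq> 1" and p1: "\<And>k. 0 < k \<Longrightarrow> p * Q ^ k \<noteq> 1"
    and v0: "v0 = p * Q ^ M * u0"
    and I: "finite I" "card I * m < M" and m: "m \<le> M"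
    and uv: "\<And>i. i \<in> I \<Longrightarrow> u i \<noteq> 0 \<and> u' i \<noteq> 0 \<and> p * u i * u' i = Q ^ Suc m * v i * v' i"
  shows "wp_sum p Q M u0 v0 I u v u' v' = 0"
proof -
  define U where "U k = inverse Q ^ k + p * Q ^ k" for k
  have "\<exists>g. degree g \<le> m \<and> (\<forall>k\<le>M. wp_pair p Q M k (u i) (v i) (u' i) (v' i) = poly g (U k))"
    if "i \<in> I" for i
  proof -
    have "u i \<noteq> 0" "u' i \<noteq> 0" "p * u i * u' i = Q ^ Suc m * v i * v' i"
      using uv[OF that] by auto
    from wp_pair_polynomial[OF nz this m] obtain g where "degree g \<le> m"
      "\<And>k. k \<le> M \<Longrightarrow> wp_pair p Q M k (u i) (v i) (u' i) (v' i) = poly g (U k)"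
      unfolding U_def by blast
    then show ?thesis by blast
  qed
  then obtain g where g: "\<And>i. i \<in> I \<Longrightarrow> degree (g i) \<le> m"
    "\<And>i k. i \<in> I \<Longrightarrow> k \<le> M \<Longrightarrow> wp_pair p Q M k (u i) (v i) (u' i) (v' i) = poly (g i) (U k)"
    by metis
  obtain K where K: "\<And>k. k \<le> M \<Longrightarrow> (inverse Q ^ k - p * Q ^ k) * wp_pair p Q M k 1 1 u0 v0 *
      (\<Prod>j\<in>{..M} - {k}. U k - U j) = K"
    using wp_pair_node_differences[OF nz, of M u0] unfolding v0 U_def by blast
  have inj: "inj_on U {..M}"
  proof -
    have ne: "U k \<noteq> U j" if "k < j" for j k
    proof
      assume "U k = U j"
      then have "Q ^ k * Q ^ j * U k = Q ^ k * Q ^ j * U j" by simp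
      then have "(Q ^ j - Q ^ k) * (1 - p * Q ^ (k + j)) = 0"
        using nz by (simp add: U_def power_inverse algebra_simps power_add)
      then have "Q ^ j = Q ^ k" using p1[of "k + j"] that by auto
      moreover have "Q ^ j = Q ^ k * Q ^ (j - k)" using that by (simp flip: power_add)
      ultimately show False using Q1[of "j - k"] that nz by simp
    qed
    show ?thesis by (rule inj_onI) (metis ne linorder_neqE_nat)
  qed
  define G where "G = smult K (prod g I)"
  have "degree G \<le> (\<Sum>i\<in>I. degree (g i))"
    using order.trans[OF degree_smult_le degree_prod_sum_le[OF I(1)]]
    unfolding G_def o_def .
  also have "\<dots> \<le> card I * m" using sum_bounded_above[of I "\<lambda>i. degree (g i)" m] g(1) by simp
  finally have "degree G < M" using I by simp
  have "wp_sum p Q M u0 v0 I u v u' v' = (\<Sum>k\<le>M. poly G (U k) / (\<Prod>j\<in>{..M} - {k}. U k - U j))"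
    unfolding wp_sum_def
  proof (rule sum.cong)
    fix k assume "k \<in> {..M}"
    then have k: "k \<le> M" by simp
    have "(\<Prod>j\<in>{..M} - {k}. U k - U j) \<noteq> 0"
      using k inj by (auto simp: inj_on_def)
    then have "(inverse Q ^ k - p * Q ^ k) * wp_pair p Q M k 1 1 u0 v0 = K / (\<Prod>j\<in>{..M} - {k}. U k - U j)"
      using K[OF k] by (simp add: field_simps)
    moreover have "(\<Prod>i\<in>I. wp_pair p Q M k (u i) (v i) (u' i) (v' i)) = (\<Prod>i\<in>I. poly (g i) (U k))"
      using g(2) k by (intro prod.cong) auto
    ultimately show "(inverse Q ^ k - p * Q ^ k) * wp_pair p Q M k 1 1 u0 v0 *
        (\<Prod>i\<in>I. wp_pair p Q M k (u i) (v i) (u' i) (v' i)) = poly G (U k) / (\<Prod>j\<in>{..M} - {k}. U k - U j)"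
      by (simp add: G_def poly_prod)
  qed simp
  also have "\<dots> = 0"
    by (rule sum_divided_by_node_differences_eq_0) fact+
  finally show ?thesis .
qed

section \<open>Localisation of the field of rational functions\<close>

text \<open>For irreducible \<open>\<phi>\<close> and \<open>j = 0\<close> this is the local ring of \<open>\<rat>(q)\<close> at \<open>\<phi>\<close>; for larger \<open>j\<close> it is the
  \<open>j\<close>-th power of the maximal ideal, and membership is divisibility by \<open>\<phi>^j\<close>.\<close>

definition loc :: "rat poly \<Rightarrow> nat \<Rightarrow> rat poly fract set" where
  "loc \<phi> j = {to_fract (\<phi> ^ j * a) / to_fract b | a b. b \<noteq> 0 \<and> coprime b \<phi>}"

lemma locI:
  assumes "x * to_fract b = to_fract (\<phi> ^ j * a)" "b \<noteq> 0" "coprime b \<phi>"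
  shows "x \<in> loc \<phi> j"
proof -
  have "x = to_fract (\<phi> ^ j * a) / to_fract b"
    using assms(1,2) by (simp add: field_simps)
  then show ?thesis using assms unfolding loc_def by blast
qed

lemma locE:
  assumes "x \<in> loc \<phi> j"
  obtains a b where "x * to_fract b = to_fract (\<phi> ^ j * a)" "b \<noteq> 0" "coprime b \<phi>"
proof -
  obtain a b where "x = to_fract (\<phi> ^ j * a) / to_fract b" "b \<noteq> 0" "coprime b \<phi>"
    using assms unfolding loc_def by blast
  then show thesis by (intro that[of b a]) simp_all
qed

lemma to_fract_in_loc: "\<phi> ^ j dvd a \<Longrightarrow> to_fract a \<in> loc \<phi> j"
  by (rule locI[where b = 1 and a = "a div \<phi> ^ j"]) (simp_all del: to_fract_mult)

lemma loc_0 [simp]: "0 \<in> loc \<phi> j"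
  using to_fract_in_loc[of \<phi> j 0] by simp

lemma loc_1 [simp]: "1 \<in> loc \<phi> 0"
  using to_fract_in_loc[of \<phi> 0 1] by simp

lemma loc_mult: "x \<in> loc \<phi> i \<Longrightarrow> y \<in> loc \<phi> j \<Longrightarrow> x * y \<in> loc \<phi> (i + j)"
proof (elim locE)
  fix a b c d
  assume "x * to_fract b = to_fract (\<phi> ^ i * a)" "y * to_fract d = to_fract (\<phi> ^ j * c)"
    and *: "b \<noteq> 0" "coprime b \<phi>" "d \<noteq> 0" "coprime d \<phi>"
  then have "x * y * to_fract (b * d) = to_fract (\<phi> ^ (i + j) * (a * c))"
    by (simp add: power_add mult_ac)
  then show "x * y \<in> loc \<phi> (i + j)" by (rule locI) (use * in auto)
qed

lemma loc_add: "x \<in> loc \<phi> j \<Longrightarrow> y \<in> loc \<phi> j \<Longrightarrow> x + y \<in> loc \<phi> j"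
proof (elim locE)
  fix a b c d
  assume x: "x * to_fract b = to_fract (\<phi> ^ j * a)" and y: "y * to_fract d = to_fract (\<phi> ^ j * c)"
    and *: "b \<noteq> 0" "coprime b \<phi>" "d \<noteq> 0" "coprime d \<phi>"
  have "(x + y) * to_fract (b * d) = (x * to_fract b) * to_fract d + (y * to_fract d) * to_fract b"
    by (simp add: algebra_simps)
  also have "\<dots> = to_fract (\<phi> ^ j * (a * d + c * b))"
    unfolding x y by (simp add: algebra_simps)
  finally show "x + y \<in> loc \<phi> j" by (rule locI) (use * in auto)
qed

lemma loc_mult_left: "x \<in> loc \<phi> 0 \<Longrightarrow> y \<in> loc \<phi> j \<Longrightarrow> x * y \<in> loc \<phi> j"
  using loc_mult[of x \<phi> 0 y j] by simp

lemma loc_mult_right: "x \<in> loc \<phi> j \<Longrightarrow> y \<in> loc \<phi> 0 \<Longrightarrow> x * y \<in> loc \<phi> j"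
  using loc_mult[of x \<phi> j y 0] by simp

lemma loc_uminus: "x \<in> loc \<phi> j \<Longrightarrow> - x \<in> loc \<phi> j"
proof (elim locE)
  fix a b
  assume "x * to_fract b = to_fract (\<phi> ^ j * a)" "b \<noteq> 0" "coprime b \<phi>"
  then show "- x \<in> loc \<phi> j" by (intro locI[where a = "- a" and b = b]) auto
qed

lemma loc_diff: "x \<in> loc \<phi> j \<Longrightarrow> y \<in> loc \<phi> j \<Longrightarrow> x - y \<in> loc \<phi> j"
  using loc_add[of x \<phi> j "- y"] loc_uminus[of y \<phi> j] by simp

lemma loc_antimono: "i \<le> j \<Longrightarrow> x \<in> loc \<phi> j \<Longrightarrow> x \<in> loc \<phi> i"
proof (elim locE)
  fix a b
  assume "i \<le> j" "x * to_fract b = to_fract (\<phi> ^ j * a)" "b \<noteq> 0" "coprime b \<phi>"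
  then show "x \<in> loc \<phi> i"
    by (intro locI[where a = "\<phi> ^ (j - i) * a" and b = b]) (auto simp flip: mult.assoc power_add)
qed

lemma loc_sum: "(\<And>i. i \<in> A \<Longrightarrow> f i \<in> loc \<phi> j) \<Longrightarrow> sum f A \<in> loc \<phi> j"
  by (induction A rule: infinite_finite_induct) (auto intro: loc_add)

lemma loc_prod: "(\<And>i. i \<in> A \<Longrightarrow> f i \<in> loc \<phi> 0) \<Longrightarrow> prod f A \<in> loc \<phi> 0"
  by (induction A rule: infinite_finite_induct) (auto intro: loc_mult_left)

lemma loc_power: "x \<in> loc \<phi> j \<Longrightarrow> x ^ k \<in> loc \<phi> (k * j)"
  by (induction k) (auto intro: loc_mult)

lemma loc_power_0: "x \<in> loc \<phi> 0 \<Longrightarrow> x ^ k \<in> loc \<phi> 0"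
  using loc_power[of x \<phi> 0 k] by simp

lemma loc_imp_dvd_numerator:
  assumes "x \<in> loc \<phi> j"
  shows "\<phi> ^ j dvd fst (quot_of_fract x)"
proof -
  obtain a b where ab: "x * to_fract b = to_fract (\<phi> ^ j * a)" "b \<noteq> 0" "coprime b \<phi>"
    using assms by (rule locE)
  define r s where "r = fst (quot_of_fract x)" and "s = snd (quot_of_fract x)"
  have s: "s \<noteq> 0" by (simp add: s_def)
  have "x = Fract r s" by (simp add: r_def s_def)
  then have "x * to_fract s = to_fract r"
    using s by (simp add: to_fract_def mult_fract eq_fract)
  then have "to_fract (r * b) = to_fract (\<phi> ^ j * a * s)"
    using ab(1) by (simp add: to_fract_mult) (metis mult.assoc mult.commute)
  then have "r * b = \<phi> ^ j * a * s" by (simp only: to_fract_eq_iff)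
  then have "\<phi> ^ j dvd r * b" by (simp add: mult.assoc)
  moreover have "coprime (\<phi> ^ j) b" using ab(3) by (simp add: coprime_commute)
  ultimately show ?thesis by (simp add: coprime_dvd_mult_left_iff r_def)
qed

definition loc_unit :: "rat poly \<Rightarrow> rat poly fract \<Rightarrow> bool" where
  "loc_unit \<phi> x \<longleftrightarrow> x \<in> loc \<phi> 0 \<and> inverse x \<in> loc \<phi> 0"

lemma loc_unit_to_fract: "b \<noteq> 0 \<Longrightarrow> coprime b \<phi> \<Longrightarrow> loc_unit \<phi> (to_fract b)"
  unfolding loc_unit_def
  by (auto intro!: to_fract_in_loc locI[where b = b and a = 1])

lemma loc_unit_1 [simp]: "loc_unit \<phi> 1"
  by (simp add: loc_unit_def)

lemma loc_unit_mult: "loc_unit \<phi> x \<Longrightarrow> loc_unit \<phi> y \<Longrightarrow> loc_unit \<phi> (x * y)"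
  by (auto simp: loc_unit_def intro: loc_mult_left)

lemma loc_unit_prod: "(\<And>i. i \<in> A \<Longrightarrow> loc_unit \<phi> (f i)) \<Longrightarrow> loc_unit \<phi> (prod f A)"
  by (induction A rule: infinite_finite_induct) (auto intro: loc_unit_mult)

lemma loc_unit_power: "loc_unit \<phi> x \<Longrightarrow> loc_unit \<phi> (x ^ k)"
  by (induction k) (auto intro: loc_unit_mult)

lemma loc_divide: "x \<in> loc \<phi> j \<Longrightarrow> loc_unit \<phi> y \<Longrightarrow> x / y \<in> loc \<phi> j"
  by (auto simp: loc_unit_def divide_inverse intro: loc_mult_right)

lemma to_fract_of_nat: "to_fract (of_nat n :: rat poly) = of_nat n"
  by (induction n) simp_all

lemma of_nat_fract_neq_0: "n > 0 \<Longrightarrow> of_nat n \<noteq> (0 :: rat poly fract)"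
  by (simp flip: to_fract_of_nat)

lemma loc_unit_of_nat: "n > 0 \<Longrightarrow> loc_unit \<phi> (of_nat n)"
proof -
  assume n: "n > 0"
  have "is_unit (of_nat n :: rat poly)"
    using n by (simp add: of_nat_poly is_unit_pCons_iff)
  then have "coprime (of_nat n) \<phi>" by (rule is_unit_left_imp_coprime)
  then show "loc_unit \<phi> (of_nat n)"
    using n loc_unit_to_fract[of "of_nat n" \<phi>] by (simp add: to_fract_of_nat)
qed

lemma of_nat_in_loc: "of_nat n \<in> loc \<phi> 0"
  using loc_unit_of_nat[of n \<phi>] by (cases n) (auto simp: loc_unit_def simp del: of_nat_Suc)

definition loc_cong :: "rat poly \<Rightarrow> rat poly fract \<Rightarrow> rat poly fract \<Rightarrow> bool" where
  "loc_cong \<phi> x y \<longleftrightarrow> x \<in> loc \<phi> 0 \<and> y \<in> loc \<phi> 0 \<and> x - y \<in> loc \<phi> 1"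

lemma loc_cong_refl: "x \<in> loc \<phi> 0 \<Longrightarrow> loc_cong \<phi> x x"
  by (simp add: loc_cong_def)

lemma loc_cong_diff: "loc_cong \<phi> x y \<Longrightarrow> loc_cong \<phi> x' y' \<Longrightarrow> loc_cong \<phi> (x - x') (y - y')"
  unfolding loc_cong_def using loc_diff[of "x - y" \<phi> 1 "x' - y'"]
  by (auto intro: loc_diff simp: algebra_simps)

lemma loc_cong_mult:
  assumes "loc_cong \<phi> x y" "loc_cong \<phi> x' y'"
  shows "loc_cong \<phi> (x * x') (y * y')"
proof -
  have "x * x' - y * y' = x * (x' - y') + (x - y) * y'" by (simp add: algebra_simps)
  then show ?thesis
    using assms unfolding loc_cong_def
    by (auto intro: loc_mult_left loc_mult_right loc_add)
qed

lemma loc_cong_prod: "(\<And>i. i \<in> A \<Longrightarrow> loc_cong \<phi> (f i) (g i)) \<Longrightarrow> loc_cong \<phi> (prod f A) (prod g A)"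
  by (induction A rule: infinite_finite_induct) (auto intro: loc_cong_mult loc_cong_refl)

lemma loc_cong_sum: "(\<And>i. i \<in> A \<Longrightarrow> loc_cong \<phi> (f i) (g i)) \<Longrightarrow> loc_cong \<phi> (sum f A) (sum g A)"
proof (induction A rule: infinite_finite_induct)
  case (insert a A)
  then have "loc_cong \<phi> (f a) (g a)" "loc_cong \<phi> (sum f A) (sum g A)" by auto
  then have "loc_cong \<phi> (f a + sum f A) (g a + sum g A)"
    unfolding loc_cong_def using loc_add[of "f a - g a" \<phi> 1 "sum f A - sum g A"]
    by (auto intro: loc_add simp: algebra_simps)
  then show ?case using insert by simp
qed (auto intro: loc_cong_refl)

lemma loc_cong_power: "loc_cong \<phi> x y \<Longrightarrow> loc_cong \<phi> (x ^ k) (y ^ k)"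
  by (induction k) (auto intro: loc_cong_mult loc_cong_refl)

lemma loc_cong_inverse:
  assumes "loc_cong \<phi> x y" "loc_unit \<phi> x" "loc_unit \<phi> y" "x \<noteq> 0" "y \<noteq> 0"
  shows "loc_cong \<phi> (inverse x) (inverse y)"
proof -
  have "inverse x - inverse y = inverse x * (- (x - y)) * inverse y"
    using assms by (simp add: field_simps)
  then show ?thesis
    using assms unfolding loc_cong_def loc_unit_def
    by (simp only:) (intro conjI loc_mult_right[OF loc_mult_left] loc_uminus; simp)
qed

lemma loc_cong_0_iff: "loc_cong \<phi> x 0 \<longleftrightarrow> x \<in> loc \<phi> 1"
  using loc_antimono[of 0 1 x \<phi>] by (auto simp: loc_cong_def)

definition loc_poly :: "rat poly \<Rightarrow> nat \<Rightarrow> (rat poly fract \<Rightarrow> rat poly fract) \<Rightarrow> bool" where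
  "loc_poly \<phi> j f \<longleftrightarrow> (\<exists>p. (\<forall>i. coeff p i \<in> loc \<phi> j) \<and> f = poly p)"

lemma poly_in_loc:
  assumes "\<And>i. coeff p i \<in> loc \<phi> j" "x \<in> loc \<phi> 0"
  shows "poly p x \<in> loc \<phi> j"
  unfolding poly_altdef using assms by (intro loc_sum loc_mult_right loc_power_0)

lemma loc_poly_eval: "loc_poly \<phi> j f \<Longrightarrow> x \<in> loc \<phi> 0 \<Longrightarrow> f x \<in> loc \<phi> j"
  unfolding loc_poly_def using poly_in_loc by auto

lemma loc_poly_const: "c \<in> loc \<phi> j \<Longrightarrow> loc_poly \<phi> j (\<lambda>x. c)"
  unfolding loc_poly_def by (intro exI[of _ "[:c:]"]) (auto simp: coeff_pCons split: nat.split)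

lemma loc_poly_id: "loc_poly \<phi> 0 (\<lambda>x. x)"
  unfolding loc_poly_def by (intro exI[of _ "[:0, 1:]"]) (auto simp: coeff_pCons split: nat.split)

lemma loc_poly_add: "loc_poly \<phi> j f \<Longrightarrow> loc_poly \<phi> j g \<Longrightarrow> loc_poly \<phi> j (\<lambda>x. f x + g x)"
  unfolding loc_poly_def
proof (elim exE conjE)
  fix p r assume "\<forall>i. coeff p i \<in> loc \<phi> j" "f = poly p" "\<forall>i. coeff r i \<in> loc \<phi> j" "g = poly r"
  then show "\<exists>p. (\<forall>i. coeff p i \<in> loc \<phi> j) \<and> (\<lambda>x. f x + g x) = poly p"
    by (intro exI[of _ "p + r"]) (auto intro: loc_add)
qed

lemma loc_poly_mult: "loc_poly \<phi> 0 f \<Longrightarrow> loc_poly \<phi> 0 g \<Longrightarrow> loc_poly \<phi> 0 (\<lambda>x. f x * g x)"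
  unfolding loc_poly_def
proof (elim exE conjE)
  fix p r assume "\<forall>i. coeff p i \<in> loc \<phi> 0" "f = poly p" "\<forall>i. coeff r i \<in> loc \<phi> 0" "g = poly r"
  then show "\<exists>p. (\<forall>i. coeff p i \<in> loc \<phi> 0) \<and> (\<lambda>x. f x * g x) = poly p"
    by (intro exI[of _ "p * r"]) (auto simp: coeff_mult intro: loc_sum loc_mult_left)
qed

lemma loc_poly_diff: "loc_poly \<phi> 0 f \<Longrightarrow> loc_poly \<phi> 0 g \<Longrightarrow> loc_poly \<phi> 0 (\<lambda>x. f x - g x)"
  using loc_poly_add[of \<phi> 0 f "\<lambda>x. (- 1) * g x"]
    loc_poly_mult[OF loc_poly_const[OF loc_uminus[OF loc_1]], of \<phi> g] by simp

lemma loc_poly_power: "loc_poly \<phi> 0 f \<Longrightarrow> loc_poly \<phi> 0 (\<lambda>x. f x ^ k)"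
  by (induction k) (auto intro: loc_poly_mult loc_poly_const)

lemma loc_poly_prod:
  "(\<And>i. i \<in> A \<Longrightarrow> loc_poly \<phi> 0 (\<lambda>x. f x i)) \<Longrightarrow> loc_poly \<phi> 0 (\<lambda>x. \<Prod>i\<in>A. f x i)"
  by (induction A rule: infinite_finite_induct) (auto intro: loc_poly_mult loc_poly_const)

lemma loc_poly_sum:
  "(\<And>i. i \<in> A \<Longrightarrow> loc_poly \<phi> j (\<lambda>x. f x i)) \<Longrightarrow> loc_poly \<phi> j (\<lambda>x. \<Sum>i\<in>A. f x i)"
  by (induction A rule: infinite_finite_induct) (auto intro: loc_poly_add loc_poly_const)

lemma coeff_synthetic_div_in_loc:
  assumes "\<And>i. coeff p i \<in> loc \<phi> j" "c \<in> loc \<phi> 0"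
  shows "coeff (synthetic_div p c) i \<in> loc \<phi> j"
  using assms(1)
proof (induction p arbitrary: i)
  case (pCons a p)
  have p: "coeff p i \<in> loc \<phi> j" for i using pCons.prems[of "Suc i"] by simp
  show ?case
    using pCons.IH[OF p] poly_in_loc[OF p assms(2)] by (auto simp: coeff_pCons split: nat.split)
qed simp

lemma loc_poly_root:
  assumes f: "loc_poly \<phi> j f" and r: "r \<in> loc \<phi> 0" "f r = 0"
  obtains g where "loc_poly \<phi> j g" "\<And>x. f x = (x - r) * g x"
proof -
  obtain p where p: "\<And>i. coeff p i \<in> loc \<phi> j" "f = poly p"
    using f unfolding loc_poly_def by auto
  have "f x = (x - r) * poly (synthetic_div p r) x" for x
    using arg_cong[OF synthetic_div_correct'[of r p], of "\<lambda>p. poly p x"] r p(2) by (simp add: algebra_simps)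
  moreover have "loc_poly \<phi> j (poly (synthetic_div p r))"
    unfolding loc_poly_def using coeff_synthetic_div_in_loc[OF p(1) r(1)] by blast
  ultimately show thesis by (rule that[rotated])
qed

text \<open>Differences of distinct natural numbers are units, so division by \<open>X - c0\<close> preserves the
  hypothesis for the remaining arguments and lowers the degree.\<close>

lemma coeffs_in_loc_of_values:
  assumes "\<And>c. c \<ge> c0 \<Longrightarrow> poly p (of_nat c) \<in> loc \<phi> j"
  shows "coeff p i \<in> loc \<phi> j"
  using assms
proof (induction "degree p" arbitrary: p c0 i rule: less_induct)
  case less
  let ?V = "synthetic_div p (of_nat c0)"
  have p: "p = [:- of_nat c0, 1:] * ?V + [:poly p (of_nat c0):]"
    by (rule synthetic_div_correct'[symmetric])
  have p0: "poly p (of_nat c0) \<in> loc \<phi> j" by (rule less.prems) simp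
  have V: "coeff ?V i \<in> loc \<phi> j" for i
  proof (cases "degree p = 0")
    case True
    then show ?thesis by (simp add: synthetic_div_eq_0_iff[THEN iffD2])
  next
    case False
    show ?thesis
    proof (rule less.hyps)
      show "degree ?V < degree p" using False by (simp add: degree_synthetic_div)
      fix c assume c: "c \<ge> Suc c0"
      have "poly p (of_nat c) - poly p (of_nat c0) = (of_nat c - of_nat c0) * poly ?V (of_nat c)"
        using arg_cong[OF p, of "\<lambda>p. poly p (of_nat c)"] by (simp add: algebra_simps)
      also have "of_nat c - of_nat c0 = (of_nat (c - c0) :: rat poly fract)"
        using c by (simp add: of_nat_diff)
      finally have eq: "poly p (of_nat c) - poly p (of_nat c0) = of_nat (c - c0) * poly ?V (of_nat c)" .
      have u: "loc_unit \<phi> (of_nat (c - c0))" using c by (intro loc_unit_of_nat) simp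
      have "of_nat (c - c0) \<noteq> (0 :: rat poly fract)"
        using c by (intro of_nat_fract_neq_0) simp
      then have "poly ?V (of_nat c) = (poly p (of_nat c) - poly p (of_nat c0)) / of_nat (c - c0)"
        unfolding eq by simp
      also have "\<dots> \<in> loc \<phi> j"
        using c p0 less.prems[of c] u by (intro loc_divide loc_diff) auto
      finally show "poly ?V (of_nat c) \<in> loc \<phi> j" .
    qed
  qed
  have "coeff p i = (case i of 0 \<Rightarrow> 0 | Suc i \<Rightarrow> coeff ?V i) - of_nat c0 * coeff ?V i
      + (case i of 0 \<Rightarrow> poly p (of_nat c0) | Suc i \<Rightarrow> 0)"
    by (subst p) (simp add: coeff_pCons split: nat.split)
  then show ?case
    using V p0 of_nat_in_loc[of c0 \<phi>]
    by (auto split: nat.split intro!: loc_add loc_diff loc_mult_left loc_uminus)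
qed

lemma loc_poly_of_values:
  assumes "loc_poly \<phi> 0 f" "\<And>c. c > 0 \<Longrightarrow> f (of_nat c) \<in> loc \<phi> j"
  shows "loc_poly \<phi> j f"
proof -
  obtain p where p: "f = poly p" using assms(1) unfolding loc_poly_def by auto
  have "coeff p i \<in> loc \<phi> j" for i
    using assms(2) unfolding p by (intro coeffs_in_loc_of_values[of 1]) simp
  then show ?thesis unfolding loc_poly_def p by auto
qed

section \<open>Cyclotomic polynomials\<close>

text \<open>A common factor of positive degree would have a complex root.\<close>

lemma coprime_if_no_common_complex_root:
  fixes p r :: "rat poly"
  assumes "p \<noteq> 0"
    and no_root: "\<And>z :: complex. poly (map_poly of_rat p) z = 0 \<Longrightarrow> poly (map_poly of_rat r) z \<noteq> 0"
  shows "coprime p r"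
proof (rule ccontr)
  assume "\<not> coprime p r"
  then have "\<not> is_unit (gcd p r)" by (simp only: is_unit_gcd not_False_eq_True)
  moreover have g0: "gcd p r \<noteq> 0" using assms(1) by simp
  ultimately have "degree (gcd p r) \<noteq> 0" using is_unit_iff_degree by blast
  then have "degree (map_poly of_rat (gcd p r) :: complex poly) > 0"
    by (simp add: degree_map_poly_of_rat)
  then obtain z :: complex where z: "poly (map_poly of_rat (gcd p r)) z = 0"
    using alg_closed_imp_poly_has_root by blast
  have root: "poly (map_poly of_rat s) z = 0" if "gcd p r dvd s" for s
  proof -
    from that obtain t where "s = gcd p r * t" by (elim dvdE)
    then show ?thesis using z by (simp add: map_poly_of_rat_mult)
  qed
  show False using no_root[OF root[OF gcd_dvd1]] root[OF gcd_dvd2] by simp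
qed

lemma cis_power_eq_1_iff:
  assumes "m > 0"
  shows "cis (2 * pi / real m) ^ j = 1 \<longleftrightarrow> m dvd j"
proof -
  let ?z = "cis (2 * pi / real m)"
  have zm: "?z ^ m = 1" using assms by (simp add: DeMoivre)
  have "?z ^ j = ?z ^ (m * (j div m) + j mod m)" by (simp only: mult_div_mod_eq)
  also have "\<dots> = ?z ^ (j mod m)" by (simp only: power_add power_mult zm power_one mult_1_left)
  finally have red: "?z ^ j = ?z ^ (j mod m)" .
  have inj: "inj_on (\<lambda>k. cis (2 * pi * real k / real m)) {..<m}"
    using bij_betw_roots_unity[OF assms] by (rule bij_betw_imp_inj_on)
  have "?z ^ (j mod m) = 1 \<longleftrightarrow> j mod m = 0"
    unfolding cis_mult_pow using inj_onD[OF inj, of "j mod m" 0] assms by force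
  then show ?thesis unfolding red by (simp add: mod_eq_0_iff_dvd)
qed

lemma cyclotomic_complex_root_power_eq_1_iff:
  assumes "m > 0" "poly (cyclotomic_complex m) z = 0"
  shows "z ^ e = 1 \<longleftrightarrow> m dvd e"
proof -
  define w where "w = cis (2 * pi / real m)"
  define A where "A = {k \<in> {1..m}. gcd m k = 1}"
  have "finite A" by (simp add: A_def)
  moreover have "(\<Prod>k\<in>A. poly [:- (w ^ k), 1:] z) = 0"
    using assms(2) unfolding cyclotomic_complex_def poly_prod w_def A_def .
  ultimately have "\<exists>k\<in>A. poly [:- (w ^ k), 1:] z = 0" by (simp only: prod_zero_iff)
  then obtain k where "k \<in> A" "poly [:- (w ^ k), 1:] z = 0" by blast
  then have k: "gcd m k = 1" "z = w ^ k" by (auto simp: A_def)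
  have "z ^ e = cis (2 * pi / real m) ^ (k * e)" unfolding k(2) w_def by (simp only: power_mult)
  moreover have "coprime m k" unfolding coprime_iff_gcd_eq_1 by (rule k(1))
  ultimately show ?thesis
    using cis_power_eq_1_iff[OF assms(1)] by (simp add: coprime_dvd_mult_right_iff)
qed

lemma cyclotomic_neq_0: "cyclotomic m \<noteq> 0"
proof
  assume "cyclotomic m = 0"
  then have "cyclotomic_complex m = 0" using of_rat_cyclotomic[of m] by simp
  then show False by (simp add: cyclotomic_complex_def)
qed

lemma map_poly_of_rat_minus_monom:
  "map_poly of_rat (1 - monom 1 e) = (1 - monom 1 e :: complex poly)"
  by (intro poly_eqI) (simp add: coeff_map_poly of_rat_diff)

lemma coprime_one_minus_monom_cyclotomic:
  assumes "m > 0" "\<not> m dvd e"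
  shows "coprime (1 - monom 1 e) (cyclotomic m)"
proof (subst coprime_commute, rule coprime_if_no_common_complex_root[OF cyclotomic_neq_0])
  fix z :: complex assume "poly (map_poly of_rat (cyclotomic m)) z = 0"
  then have "z ^ e \<noteq> 1"
    using cyclotomic_complex_root_power_eq_1_iff[OF assms(1), of z e] assms(2)
    by (simp add: of_rat_cyclotomic)
  then show "poly (map_poly of_rat (1 - monom 1 e)) z \<noteq> 0"
    by (simp add: map_poly_of_rat_minus_monom poly_monom)
qed

lemma coprime_X_cyclotomic:
  assumes "m > 0"
  shows "coprime [:0, 1:] (cyclotomic m)"
proof (subst coprime_commute, rule coprime_if_no_common_complex_root[OF cyclotomic_neq_0])
  fix z :: complex assume "poly (map_poly of_rat (cyclotomic m)) z = 0"
  then have "z ^ m = 1" using cyclotomic_complex_root_power_eq_1_iff[OF assms, of z m] by (simp add: of_rat_cyclotomic)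
  then have "z \<noteq> 0" using assms by (auto simp: power_0_left)
  then show "poly (map_poly of_rat [:0, 1:]) z \<noteq> 0" by (simp add: map_poly_pCons)
qed

lemma coprime_cyclotomic:
  assumes "m > 0" "m' > 0" "m \<noteq> m'"
  shows "coprime (cyclotomic m) (cyclotomic m')"
proof (rule coprime_if_no_common_complex_root[OF cyclotomic_neq_0], rule notI)
  fix z :: complex assume "poly (map_poly of_rat (cyclotomic m)) z = 0" "poly (map_poly of_rat (cyclotomic m')) z = 0"
  then have *: "m dvd e \<longleftrightarrow> m' dvd e" for e
    using cyclotomic_complex_root_power_eq_1_iff[OF assms(1), of z e]
      cyclotomic_complex_root_power_eq_1_iff[OF assms(2), of z e] by (simp add: of_rat_cyclotomic)
  show False using *[of m] *[of m'] assms(3) by (simp add: dvd_antisym)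
qed

lemma prod_cyclotomic:
  assumes "n > 0"
  shows "(\<Prod>m\<in>{m. m dvd n}. cyclotomic m) = monom 1 n - 1"
proof (rule map_poly_of_rat_inj)
  have "map_poly of_rat (monom 1 n - 1) = (monom 1 n - 1 :: complex poly)"
    by (intro poly_eqI) (simp add: coeff_map_poly of_rat_diff)
  then show "map_poly of_rat (\<Prod>m\<in>{m. m dvd n}. cyclotomic m) = (map_poly of_rat (monom 1 n - 1) :: complex poly)"
    by (simp add: map_poly_of_rat_prod of_rat_cyclotomic prod_cyclotomic_complex[OF assms])
qed

lemma cyclotomic_dvd_one_minus_monom:
  assumes "m > 0" "m dvd e"
  shows "cyclotomic m dvd 1 - monom 1 e"
proof (cases "e = 0")
  case False
  then have "cyclotomic m dvd (\<Prod>m\<in>{m. m dvd e}. cyclotomic m)"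
    using assms by (intro dvd_prodI) auto
  then have "cyclotomic m dvd monom 1 e - 1" using False by (simp add: prod_cyclotomic)
  then have "cyclotomic m dvd - (monom 1 e - 1)" by (simp only: dvd_minus_iff)
  then show ?thesis by (simp only: minus_diff_eq)
qed (simp add: monom_eq_1)

lemma cyclotomic_1: "cyclotomic 1 = monom 1 1 - 1"
  using prod_cyclotomic[of 1] by simp

lemma qint_poly_eq_prod_cyclotomic:
  assumes "n > 0"
  shows "qint_poly n = (\<Prod>m\<in>{m. m dvd n} - {1}. cyclotomic m)"
proof -
  have "(monom 1 1 - 1) * qint_poly n = monom 1 n - 1"
    using power_diff_1_eq[of "monom 1 1 :: rat poly" n]
    by (simp add: qint_poly_def monom_power)
  also have "\<dots> = (monom 1 1 - 1) * (\<Prod>m\<in>{m. m dvd n} - {1}. cyclotomic m)"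
    using prod.remove[of "{m. m dvd n}" 1 cyclotomic] assms
    by (simp add: prod_cyclotomic cyclotomic_1[simplified])
  finally show ?thesis using cyclotomic_neq_0[of 1] unfolding cyclotomic_1 by simp
qed

lemma qvar_power: "qvar ^ e = to_fract (monom 1 e)"
  by (simp add: qvar_def monom_altdef to_fract_power)

lemma one_minus_qvar_power: "1 - qvar ^ e = to_fract (1 - monom 1 e)"
  by (simp add: qvar_power)

lemma qvar_power_neq_1: "e > 0 \<Longrightarrow> qvar ^ e \<noteq> 1"
proof
  assume "e > 0" "qvar ^ e = 1"
  then have "to_fract (monom 1 e) = to_fract (1 :: rat poly)" by (simp add: qvar_power del: to_fract_eq_iff)
  then have "monom 1 e = (1 :: rat poly)" by (simp only: to_fract_eq_iff)
  then have "degree (monom 1 e :: rat poly) = 0" by simp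
  then show False using \<open>e > 0\<close> by (simp add: degree_monom_eq)
qed

context
  fixes m :: nat
  assumes m: "m > 0"
begin

lemma loc_unit_qvar: "loc_unit (cyclotomic m) qvar"
  unfolding qvar_def using coprime_X_cyclotomic[OF m] by (intro loc_unit_to_fract) auto

lemma loc_unit_one_minus_qvar_power: "\<not> m dvd e \<Longrightarrow> loc_unit (cyclotomic m) (1 - qvar ^ e)"
  unfolding one_minus_qvar_power
proof (rule loc_unit_to_fract)
  assume e: "\<not> m dvd e"
  then have "e > 0" by (auto intro: gr0I)
  then show "1 - monom 1 e \<noteq> (0 :: rat poly)"
    using qvar_power_neq_1[of e] by (auto simp: qvar_power simp del: to_fract_eq_iff)
  show "coprime (1 - monom 1 e) (cyclotomic m)"
    using e by (rule coprime_one_minus_monom_cyclotomic[OF m])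
qed

lemma one_minus_qvar_power_in_loc: "m dvd e \<Longrightarrow> 1 - qvar ^ e \<in> loc (cyclotomic m) 1"
  unfolding one_minus_qvar_power
  using cyclotomic_dvd_one_minus_monom[OF m] by (intro to_fract_in_loc) auto

end

section \<open>A two-parameter deformation and the fourth power of the cyclotomic polynomial\<close>

lemma loc_cong_wp_sum:
  assumes p: "loc_cong \<phi> p p'" "loc_cong \<phi> (Q / p) (Q / p')"
    and Q: "Q \<in> loc \<phi> 0" "inverse Q \<in> loc \<phi> 0"
    and uv: "u0 \<in> loc \<phi> 0" "v0 \<in> loc \<phi> 0"
      "\<And>i. i \<in> I \<Longrightarrow> u i \<in> loc \<phi> 0 \<and> v i \<in> loc \<phi> 0 \<and> u' i \<in> loc \<phi> 0 \<and> v' i \<in> loc \<phi> 0"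
  shows "loc_cong \<phi> (wp_sum p Q M u0 v0 I u v u' v') (wp_sum p' Q M u0 v0 I u v u' v')"
proof -
  have wp_factor: "loc_cong \<phi> (wp_factor p Q M k u v) (wp_factor p' Q M k u v)" if "u \<in> loc \<phi> 0" "v \<in> loc \<phi> 0" for k u v
    unfolding wp_factor_def
  proof (rule loc_cong_prod)
    fix j
    have "loc_cong \<phi> (v - p * Q ^ j * u) (v - p' * Q ^ j * u)"
      using that p(1) Q by (intro loc_cong_diff loc_cong_mult loc_cong_refl loc_power_0)
    moreover have "loc_cong \<phi> (u - Q ^ Suc j * v) (u - Q ^ Suc j * v)"
      using that Q by (intro loc_cong_refl loc_diff loc_mult_left loc_power_0)
    ultimately show "loc_cong \<phi> (if j < k then v - p * Q ^ j * u else u - Q ^ Suc j * v)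
        (if j < k then v - p' * Q ^ j * u else u - Q ^ Suc j * v)" by simp
  qed
  have wp_pair: "loc_cong \<phi> (wp_pair p Q M k u v u' v') (wp_pair p' Q M k u v u' v')"
    if "u \<in> loc \<phi> 0" "v \<in> loc \<phi> 0" "u' \<in> loc \<phi> 0" "v' \<in> loc \<phi> 0" for k u v u' v'
    unfolding wp_pair_def using that p(2) by (intro loc_cong_mult loc_cong_power wp_factor)
  show ?thesis
    unfolding wp_sum_def using p(1) Q uv
    by (intro loc_cong_sum loc_cong_mult loc_cong_diff loc_cong_prod wp_pair loc_cong_refl loc_power_0 loc_1) auto
qed

lemma loc_poly_wp_sum:
  assumes "p \<in> loc \<phi> 0" "Q / p \<in> loc \<phi> 0" and Q: "Q \<in> loc \<phi> 0" "inverse Q \<in> loc \<phi> 0"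
    and uv: "loc_poly \<phi> 0 u0" "loc_poly \<phi> 0 v0"
      "\<And>i. i \<in> I \<Longrightarrow> loc_poly \<phi> 0 (\<lambda>x. u x i) \<and> loc_poly \<phi> 0 (\<lambda>x. v x i) \<and>
         loc_poly \<phi> 0 (\<lambda>x. u' x i) \<and> loc_poly \<phi> 0 (\<lambda>x. v' x i)"
  shows "loc_poly \<phi> 0 (\<lambda>x. wp_sum p Q M (u0 x) (v0 x) I (u x) (v x) (u' x) (v' x))"
proof -
  have wp_factor: "loc_poly \<phi> 0 (\<lambda>x. wp_factor p Q M k (u x) (v x))" if "loc_poly \<phi> 0 u" "loc_poly \<phi> 0 v" for k u v
    unfolding wp_factor_def
  proof (rule loc_poly_prod)
    fix j
    have "loc_poly \<phi> 0 (\<lambda>x. v x - p * Q ^ j * u x)"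
      using that assms(1) Q by (intro loc_poly_diff loc_poly_mult loc_poly_const loc_power_0) auto
    moreover have "loc_poly \<phi> 0 (\<lambda>x. u x - Q ^ Suc j * v x)"
      using that Q by (intro loc_poly_diff loc_poly_mult loc_poly_const loc_power_0) auto
    ultimately show "loc_poly \<phi> 0 (\<lambda>x. if j < k then v x - p * Q ^ j * u x else u x - Q ^ Suc j * v x)"
      by (cases "j < k") simp_all
  qed
  have wp_pair: "loc_poly \<phi> 0 (\<lambda>x. wp_pair p Q M k (u x) (v x) (u' x) (v' x))"
    if "loc_poly \<phi> 0 u" "loc_poly \<phi> 0 v" "loc_poly \<phi> 0 u'" "loc_poly \<phi> 0 v'" for k u v u' v'
    unfolding wp_pair_def using that assms(2) by (intro loc_poly_mult loc_poly_const loc_power_0 wp_factor)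
  show ?thesis
    unfolding wp_sum_def using assms(1) Q uv
    by (intro loc_poly_sum loc_poly_mult loc_poly_prod wp_pair loc_poly_const loc_power_0 loc_1 loc_diff loc_mult_left) auto
qed

text \<open>The parameters \<open>1, x^{1-d}, x X^i, X^{-i}\<close> (\<open>1 \<le> i < d\<close>) are chosen so that at \<open>x = 1\<close> they form a multiset
  closed under inversion, while at \<open>x = q^n\<close>, and at \<open>x = 1\<close> for \<open>X = q^n\<close>, they
  include \<open>q^{-(d-1)n} = q Q^{-M}\<close> and the others (apart from one \<open>1\<close>) form pairs with product \<open>q^n\<close>.\<close>

abbreviation q_family :: "nat \<Rightarrow> nat \<Rightarrow> rat poly fract \<Rightarrow> rat poly fract \<Rightarrow> rat poly fract" where
  "q_family d M x X \<equiv> wp_sum (inverse qvar) (qvar ^ d) M 1 (x ^ (d - 1)) {1..<d}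
     (\<lambda>i. x * X ^ i) (\<lambda>i. 1) (\<lambda>i. 1) (\<lambda>i. X ^ i)"

lemma loc_cong_qvar_power:
  assumes "m > 0" "a \<le> b" "m dvd b - a"
  shows "loc_cong (cyclotomic m) (qvar ^ a) (qvar ^ b)"
proof -
  have q: "qvar \<in> loc (cyclotomic m) 0" using loc_unit_qvar[OF assms(1)] by (simp add: loc_unit_def)
  have "qvar ^ b = qvar ^ a * qvar ^ (b - a)" using assms(2) by (simp flip: power_add)
  then have "qvar ^ a - qvar ^ b = qvar ^ a * (1 - qvar ^ (b - a))" by (simp add: algebra_simps)
  then show ?thesis
    unfolding loc_cong_def using q one_minus_qvar_power_in_loc[OF assms(1,3)]
    by (auto intro: loc_power_0 loc_mult_left)
qed

text \<open>The hypothesis says that \<open>1/q\<close> and \<open>Q^{-M}\<close> agree modulo \<open>\<Phi>_m\<close>, and at \<open>p = Q^{-M}\<close> the sum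
  vanishes by reflection.\<close>

lemma wp_sum_qvar_in_loc_1:
  assumes m: "m > 0" and M: "d * M > 0" "m dvd d * M - 1"
    and uv: "u0 \<in> loc (cyclotomic m) 0" "v0 \<in> loc (cyclotomic m) 0"
      "\<And>i. i \<in> I \<Longrightarrow> u i \<in> loc (cyclotomic m) 0 \<and> v i \<in> loc (cyclotomic m) 0 \<and>
         u' i \<in> loc (cyclotomic m) 0 \<and> v' i \<in> loc (cyclotomic m) 0"
  shows "wp_sum (inverse qvar) (qvar ^ d) M u0 v0 I u v u' v' \<in> loc (cyclotomic m) 1"
proof -
  let ?\<phi> = "cyclotomic m" and ?Q = "qvar ^ d"
  let ?p = "inverse (?Q ^ M)"
  have u: "loc_unit ?\<phi> (qvar ^ e)" for e by (intro loc_unit_power loc_unit_qvar m)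
  have nz: "qvar ^ e \<noteq> 0" for e by (simp add: qvar_neq_0)
  have cong: "loc_cong ?\<phi> qvar (?Q ^ M)"
    using loc_cong_qvar_power[OF m, of 1 "d * M"] M by (simp add: power_mult)
  have 1: "loc_cong ?\<phi> (inverse qvar) ?p"
    using cong u[of 1] u[of "d * M"] nz[of 1] nz[of "d * M"] unfolding power_mult
    by (intro loc_cong_inverse) simp_all
  have 2: "loc_cong ?\<phi> (?Q / inverse qvar) (?Q / ?p)"
    using cong u[of d] by (simp add: divide_inverse) (intro loc_cong_mult loc_cong_refl; simp add: loc_unit_def)
  have "loc_cong ?\<phi> (wp_sum (inverse qvar) ?Q M u0 v0 I u v u' v') (wp_sum ?p ?Q M u0 v0 I u v u' v')"
    using u[of d] by (intro loc_cong_wp_sum 1 2 uv) (simp_all add: loc_unit_def)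
  also have "wp_sum ?p ?Q M u0 v0 I u v u' v' = 0"
    by (rule wp_sum_reflect_eq_0) (use of_nat_fract_neq_0[of 2] in \<open>simp_all add: qvar_neq_0\<close>)
  finally show ?thesis by (simp only: loc_cong_0_iff)
qed

text \<open>The relation \<open>p u u' = Q^{l+1} v v'\<close> reads \<open>u u' = q^n v v'\<close> here, and the degree bound holds
  because at most \<open>d - 1\<close> pairs of degree \<open>l\<close> are compared with \<open>M = (d-1)(l+1) + 1\<close>.\<close>

lemma wp_sum_qvar_eq_0:
  assumes d: "d \<ge> 2" and n: "n = d * Suc l + 1" and M: "M = (d - 1) * Suc l + 1"
    and v0: "v0 = qvar ^ ((d - 1) * n) * u0"
    and I: "finite I" "card I < d"
    and uv: "\<And>i. i \<in> I \<Longrightarrow> u i \<noteq> 0 \<and> u' i \<noteq> 0 \<and> u i * u' i = qvar ^ n * v i * v' i"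
  shows "wp_sum (inverse qvar) (qvar ^ d) M u0 v0 I u v u' v' = 0"
proof -
  have dM: "d * M = Suc ((d - 1) * n)"
    using d unfolding M n by (cases d) (simp_all add: algebra_simps)
  have q: "inverse qvar * qvar ^ Suc e = qvar ^ e" for e using qvar_neq_0 by simp
  show ?thesis
  proof (rule wp_sum_Karlsson_Minton_eq_0[where m = l])
    show "inverse qvar \<noteq> 0" "qvar ^ d \<noteq> 0" using qvar_neq_0 by simp_all
    show "(qvar ^ d) ^ k \<noteq> 1" if "0 < k" for k
      unfolding power_mult[symmetric] using that d by (intro qvar_power_neq_1) simp
    show "inverse qvar * (qvar ^ d) ^ k \<noteq> 1" if k: "0 < k" for k
    proof -
      have "d * 1 \<le> d * k" using k by (intro mult_le_mono2) simp
      then have dk: "d * k \<ge> 2" using d by linarith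
      then have "Suc (d * k - 1) = d * k" by simp
      then have "inverse qvar * (qvar ^ d) ^ k = qvar ^ (d * k - 1)"
        using q[of "d * k - 1"] by (simp only: power_mult)
      then show ?thesis using dk qvar_power_neq_1[of "d * k - 1"] by simp
    qed
    show "v0 = inverse qvar * (qvar ^ d) ^ M * u0"
      unfolding v0 power_mult[symmetric] dM q ..
    have "card I * l \<le> (d - 1) * l" using I by (intro mult_le_mono1) simp
    then show "card I * l < M" unfolding M using d by (simp only: mult_Suc_right)
    have "1 * l \<le> (d - 1) * l" using d by (intro mult_le_mono1) simp
    then show "l \<le> M" unfolding M mult_Suc_right by linarith
    show "finite I" by fact
    fix i assume "i \<in> I"
    then have u: "u i \<noteq> 0" "u' i \<noteq> 0" "u i * u' i = qvar ^ n * v i * v' i" using uv by auto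
    have "inverse qvar * u i * u' i = (inverse qvar * qvar ^ Suc (d * Suc l)) * v i * v' i"
      using u(3) unfolding n by (simp add: mult.assoc)
    then have "inverse qvar * u i * u' i = (qvar ^ d) ^ Suc l * v i * v' i"
      unfolding q power_mult .
    then show "u i \<noteq> 0 \<and> u' i \<noteq> 0 \<and> inverse qvar * u i * u' i = (qvar ^ d) ^ Suc l * v i * v' i"
      using u by simp
  qed
qed

lemma q_family_eq_0_left:
  assumes d: "d \<ge> 2" and n: "n = d * Suc l + 1" and M: "M = (d - 1) * Suc l + 1" and X: "X \<noteq> 0"
  shows "q_family d M (qvar ^ n) X = 0"
  using X d qvar_neq_0
  by (intro wp_sum_qvar_eq_0[OF d n M]) (auto simp: mult.commute simp flip: power_mult)

text \<open>At \<open>x = 1\<close> the parameters may be paired anew: \<open>X^i\<close> with \<open>X^{-(i-1)}\<close>, and \<open>X^{-(d-1)}\<close> with \<open>1\<close>.\<close>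

lemma q_family_shift:
  assumes d: "d > 0"
  shows "q_family d M 1 X = wp_sum (inverse qvar) (qvar ^ d) M 1 (X ^ (d - 1)) {1..<d}
     (\<lambda>i. X ^ i) (\<lambda>i. 1) (\<lambda>i. 1) (\<lambda>i. X ^ (i - 1))"
proof -
  let ?p = "inverse qvar" and ?Q = "qvar ^ d"
  have "wp_pair ?p ?Q M k 1 1 1 1 * (\<Prod>i\<in>{1..<d}. wp_pair ?p ?Q M k (X ^ i) 1 1 (X ^ i)) =
      wp_pair ?p ?Q M k 1 1 1 (X ^ (d - 1)) * (\<Prod>i\<in>{1..<d}. wp_pair ?p ?Q M k (X ^ i) 1 1 (X ^ (i - 1)))" for k
  proof -
    define g where "g i = wp_factor ?p ?Q M k 1 (X ^ i)" for i
    obtain e where e: "d = Suc e" using d by (cases d) auto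
    have I: "{1..<d} = {Suc 0..<Suc e}" by (simp add: e)
    have "prod g {0..<Suc e} = g 0 * prod g {Suc 0..<Suc e}"
      by (subst prod.atLeast_Suc_lessThan) simp_all
    moreover have "prod g {0..<Suc e} = g e * prod g {0..<e}"
      by (simp add: mult.commute)
    moreover have "(\<Prod>i\<in>{1..<d}. g (i - 1)) = prod g {0..<e}"
      unfolding I prod.shift_bounds_Suc_ivl by simp
    ultimately have "g 0 * prod g {1..<d} = g (d - 1) * (\<Prod>i\<in>{1..<d}. g (i - 1))"
      by (simp add: I e)
    then show ?thesis
      unfolding wp_pair_def prod.distrib g_def[symmetric]
      by (simp add: g_def[of 0, simplified, symmetric] mult_ac)
  qed
  then show ?thesis unfolding wp_sum_def by (simp add: mult.assoc)
qed

lemma q_family_eq_0_right: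
  assumes d: "d \<ge> 2" and n: "n = d * Suc l + 1" and M: "M = (d - 1) * Suc l + 1"
  shows "q_family d M 1 (qvar ^ n) = 0"
proof -
  have "qvar ^ n * (qvar ^ n) ^ (i - 1) = (qvar ^ n) ^ i" if "i \<ge> 1" for i
    using that by (simp flip: power_Suc)
  then show ?thesis
    unfolding q_family_shift[OF order.strict_trans2[OF zero_less_numeral d]] using d qvar_neq_0
    by (intro wp_sum_qvar_eq_0[OF d n M]) (auto simp: mult.commute simp flip: power_mult)
qed

text \<open>Replacing \<open>X\<close> by its inverse exchanges the two members of each pair up to scaling the
  homogeneous coordinates, which gives a factor that does not depend on \<open>k\<close>.\<close>

lemma q_family_inverse:
  assumes X: "X \<noteq> 0" and 0: "q_family d M 1 X = 0"
  shows "q_family d M 1 (inverse X) = 0"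
proof -
  let ?p = "inverse qvar" and ?Q = "qvar ^ d"
  have "wp_pair ?p ?Q M k (1 * inverse X ^ i) 1 1 (inverse X ^ i) =
      (inverse X ^ i) ^ M * (inverse X ^ i) ^ M * wp_pair ?p ?Q M k (1 * X ^ i) 1 1 (X ^ i)" for i k
  proof -
    have XX: "inverse X ^ i * X ^ i = 1" using X by (simp add: power_inverse)
    show ?thesis
      using wp_factor_scale[of ?p ?Q M k "inverse X ^ i" 1 "X ^ i"]
        wp_factor_scale[of ?p ?Q M k "inverse X ^ i" "X ^ i" 1]
      unfolding XX by (simp add: wp_pair_def)
  qed
  then have "q_family d M 1 (inverse X) =
      (\<Prod>i\<in>{1..<d}. (inverse X ^ i) ^ M * (inverse X ^ i) ^ M) * q_family d M 1 X"
    unfolding wp_sum_def by (simp only: prod.distrib sum_distrib_left power_one mult_ac)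
  then show ?thesis using 0 by simp
qed

text \<open>The four factors \<open>\<Phi>_n\<close> come from the reflection and from the three linear factors \<open>x - q^n\<close>,
  \<open>X - q^n\<close> and \<open>X - q^{-n}\<close>, each of which is divisible by \<open>\<Phi>_n\<close> at \<open>1\<close>.\<close>

lemma q_family_in_loc_4:
  assumes d: "d \<ge> 2" and n: "n = d * Suc l + 1" and M: "M = (d - 1) * Suc l + 1"
  shows "q_family d M 1 1 \<in> loc (cyclotomic n) 4"
proof -
  let ?\<phi> = "cyclotomic n"
  have n0: "n > 0" by (simp add: n)
  have dM: "d * M = (d - 1) * n + 1"
    using d unfolding M n by (cases d) (simp_all add: algebra_simps)
  have u: "loc_unit ?\<phi> (qvar ^ e)" for e by (intro loc_unit_power loc_unit_qvar n0)
  then have q: "qvar ^ e \<in> loc ?\<phi> 0" "inverse (qvar ^ e) \<in> loc ?\<phi> 0" for e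
    by (simp_all add: loc_unit_def)
  have q1: "inverse qvar \<in> loc ?\<phi> 0" using q(2)[of 1] by simp
  have Qp: "qvar ^ d / inverse qvar \<in> loc ?\<phi> 0"
    using q(1)[of "Suc d"] by (simp add: divide_inverse mult.commute)
  have poly1: "loc_poly ?\<phi> 0 (\<lambda>x. q_family d M x (of_nat c))" for c
    by (intro loc_poly_wp_sum q1 Qp q conjI loc_poly_mult loc_poly_power loc_poly_const loc_poly_id
        loc_power_0 of_nat_in_loc loc_1)
  have poly2: "loc_poly ?\<phi> 0 (\<lambda>X. q_family d M 1 X)"
    by (intro loc_poly_wp_sum q1 Qp q conjI loc_poly_mult loc_poly_power loc_poly_const loc_poly_id
        loc_power_0 of_nat_in_loc loc_1)
  have vals: "q_family d M (of_nat a) (of_nat c) \<in> loc ?\<phi> 1" for a c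
    by (intro wp_sum_qvar_in_loc_1 conjI loc_mult_left loc_power_0 of_nat_in_loc loc_1) (simp_all add: dM n0)
  have eps: "1 - qvar ^ n \<in> loc ?\<phi> 1" "1 - inverse (qvar ^ n) \<in> loc ?\<phi> 1"
  proof -
    show *: "1 - qvar ^ n \<in> loc ?\<phi> 1" by (rule one_minus_qvar_power_in_loc[OF n0]) simp
    have "1 - inverse (qvar ^ n) = - (inverse (qvar ^ n) * (1 - qvar ^ n))"
      using qvar_neq_0 by (simp add: algebra_simps)
    then show "1 - inverse (qvar ^ n) \<in> loc ?\<phi> 1"
      using * q by (auto intro: loc_uminus loc_mult_left)
  qed
  \<comment> \<open>For a constant \<open>X = c\<close> divide by \<open>x - q^n\<close> and put \<open>x = 1\<close>.\<close>
  have "q_family d M 1 (of_nat c) \<in> loc ?\<phi> 2" if c: "c > 0" for c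
  proof -
    have 1: "loc_poly ?\<phi> 1 (\<lambda>x. q_family d M x (of_nat c))"
      by (rule loc_poly_of_values[OF poly1 vals])
    have 2: "q_family d M (qvar ^ n) (of_nat c) = 0"
      using c by (intro q_family_eq_0_left[OF d n M] of_nat_fract_neq_0)
    obtain g where g: "loc_poly ?\<phi> 1 g"
      "\<And>x. q_family d M x (of_nat c) = (x - qvar ^ n) * g x"
      by (rule loc_poly_root[OF 1 q(1) 2], rule that)
    show ?thesis unfolding g(2)
      using loc_mult[OF eps(1) loc_poly_eval[OF g(1) loc_1]] by (simp add: numeral_eq_Suc)
  qed
  then have 1: "loc_poly ?\<phi> 2 (\<lambda>X. q_family d M 1 X)" by (rule loc_poly_of_values[OF poly2])
  obtain g where g: "loc_poly ?\<phi> 2 g" "\<And>X. q_family d M 1 X = (X - qvar ^ n) * g X"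
    by (rule loc_poly_root[OF 1 q(1) q_family_eq_0_right[OF d n M]], rule that)
  have "inverse (qvar ^ n) - qvar ^ n \<noteq> 0"
  proof
    assume "inverse (qvar ^ n) - qvar ^ n = 0"
    then have "qvar ^ n * inverse (qvar ^ n) = qvar ^ n * qvar ^ n" by simp
    then have "qvar ^ (n + n) = 1" using qvar_neq_0 by (simp add: power_add)
    then show False using qvar_power_neq_1[of "n + n"] n0 by simp
  qed
  moreover have "q_family d M 1 (inverse (qvar ^ n)) = 0"
    using qvar_neq_0 by (intro q_family_inverse q_family_eq_0_right[OF d n M]) simp
  ultimately have 2: "g (inverse (qvar ^ n)) = 0" using g(2)[of "inverse (qvar ^ n)"] by simp
  obtain h where h: "loc_poly ?\<phi> 2 h" "\<And>X. g X = (X - inverse (qvar ^ n)) * h X"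
    by (rule loc_poly_root[OF g(1) q(2) 2], rule that)
  have "(1 - inverse (qvar ^ n)) * h 1 \<in> loc ?\<phi> 3"
    using loc_mult[OF eps(2) loc_poly_eval[OF h(1) loc_1]] by (simp add: numeral_eq_Suc)
  then show ?thesis unfolding g(2) h(2)
    using loc_mult[OF eps(1), of _ 3] by (simp add: numeral_eq_Suc)
qed

section \<open>Blocks of terms and the smaller cyclotomic factors\<close>

definition q_ratio :: "nat \<Rightarrow> nat \<Rightarrow> rat poly fract" where
  "q_ratio d k = qpoch (inverse qvar) (qvar ^ d) k / qpoch (qvar ^ d) (qvar ^ d) k"

definition q_summand :: "nat \<Rightarrow> nat \<Rightarrow> rat poly fract" where
  "q_summand d k = qint qvar (2 * int d * int k - 1)
     * (qpoch (inverse qvar) (qvar ^ d) k ^ (2 * d) / qpoch (qvar ^ d) (qvar ^ d) k ^ (2 * d))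
     * qvar ^ (d\<^sup>2 * k)"

lemma q_summand_eq:
  "q_summand d k = (1 - inverse qvar * (qvar ^ d) ^ (2 * k)) / (1 - qvar) * q_ratio d k ^ (2 * d) * qvar ^ (d\<^sup>2 * k)"
proof -
  have "qvar powi (2 * int d * int k - 1) = qvar powi int (d * (2 * k)) / qvar"
    using qvar_neq_0 by (subst power_int_diff[symmetric, where n = 1, unfolded power_int_1_right])
       (auto simp: mult_ac)
  also have "\<dots> = inverse qvar * (qvar ^ d) ^ (2 * k)"
    unfolding power_int_of_nat power_mult by (simp only: divide_inverse mult.commute)
  finally show ?thesis
    unfolding q_summand_def qint_def q_ratio_def by (simp only: power_divide)
qed

lemma qpoch_qvar_neq_0:
  assumes "d > 0"
  shows "qpoch (qvar ^ d) (qvar ^ d) k \<noteq> 0"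
proof -
  have "qvar ^ (d * Suc j) \<noteq> 1" for j using assms by (intro qvar_power_neq_1) simp
  then show ?thesis by (simp add: qpoch_def power_add power_mult)
qed

lemma wp_factor_1_1:
  assumes "k \<le> M"
  shows "wp_factor p Q M k 1 1 * qpoch Q Q k = qpoch p Q k * qpoch Q Q M"
proof -
  have "(\<Prod>j<k. 1 - Q * Q ^ j) * (\<Prod>j=k..<M. 1 - Q * Q ^ j) = (\<Prod>j<M. 1 - Q * Q ^ j)"
    using prod.atLeastLessThan_concat[of 0 k M "\<lambda>j. 1 - Q * Q ^ j"] assms by (simp add: atLeast0LessThan)
  then show ?thesis
    unfolding wp_factor_split[OF assms] qpoch_def by (simp add: mult_ac)
qed

text \<open>Undoing the deformation gives back the truncated sum, up to a factor that is a unit at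
  \<open>\<Phi>_n\<close> as long as \<open>(Q; Q)_M\<close> is.\<close>

lemma q_family_1_1:
  assumes d: "d > 0"
  shows "q_family d M 1 1 = (1 - qvar) * qpoch (qvar ^ d) (qvar ^ d) M ^ (2 * d) * (\<Sum>k\<le>M. q_summand d k)"
proof -
  let ?p = "inverse qvar" and ?Q = "qvar ^ d"
  have q: "qvar \<noteq> 0" "1 - qvar \<noteq> 0" using qvar_neq_0 qvar_neq_1 by simp_all
  have "(inverse ?Q ^ k - ?p * ?Q ^ k) * wp_pair ?p ?Q M k 1 1 1 1 * (\<Prod>i\<in>{1..<d}. wp_pair ?p ?Q M k 1 1 1 1)
      = (1 - qvar) * qpoch ?Q ?Q M ^ (2 * d) * q_summand d k" if k: "k \<le> M" for k
  proof -
    have wp_factor: "wp_factor ?p ?Q M k 1 1 = q_ratio d k * qpoch ?Q ?Q M"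
      using wp_factor_1_1[OF k, of ?p ?Q] qpoch_qvar_neq_0[OF d, of k] by (simp add: q_ratio_def field_simps)
    have "?Q / ?p = qvar ^ Suc d" by (simp add: divide_inverse mult.commute)
    then have "((?Q / ?p) ^ k) ^ d = qvar ^ (Suc d * k * d)" by (simp only: power_mult)
    also have "Suc d * k * d = d\<^sup>2 * k + d * k" by (simp add: power2_eq_square algebra_simps)
    finally have Qp: "((?Q / ?p) ^ k) ^ d = qvar ^ (d\<^sup>2 * k) * ?Q ^ k" by (simp only: power_add power_mult)
    have inv: "inverse ?Q ^ k * ?Q ^ k = 1" using q by (simp add: power_inverse)
    have "wp_pair ?p ?Q M k 1 1 1 1 * (\<Prod>i\<in>{1..<d}. wp_pair ?p ?Q M k 1 1 1 1) = wp_pair ?p ?Q M k 1 1 1 1 ^ d"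
      using d by (simp flip: power_Suc)
    also have "\<dots> = ((?Q / ?p) ^ k) ^ d * (wp_factor ?p ?Q M k 1 1)^ (2 * d)"
      unfolding wp_pair_def by (simp only: power_mult_distrib power_add mult_2 mult.assoc)
    finally have W: "wp_pair ?p ?Q M k 1 1 1 1 * (\<Prod>i\<in>{1..<d}. wp_pair ?p ?Q M k 1 1 1 1) =
      qvar ^ (d\<^sup>2 * k) * ?Q ^ k * (q_ratio d k * qpoch ?Q ?Q M) ^ (2 * d)"
      unfolding wp_factor Qp .
    have "(inverse ?Q ^ k - ?p * ?Q ^ k) * wp_pair ?p ?Q M k 1 1 1 1 * (\<Prod>i\<in>{1..<d}. wp_pair ?p ?Q M k 1 1 1 1)
      = (inverse ?Q ^ k * ?Q ^ k - ?p * (?Q ^ k * ?Q ^ k)) * (q_ratio d k * qpoch ?Q ?Q M) ^ (2 * d) * qvar ^ (d\<^sup>2 * k)"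
      unfolding mult.assoc[of "inverse ?Q ^ k - ?p * ?Q ^ k"] W
      by (simp only: left_diff_distrib right_diff_distrib mult_ac)
    also have "\<dots> = (1 - ?p * ?Q ^ (2 * k)) * (q_ratio d k * qpoch ?Q ?Q M) ^ (2 * d) * qvar ^ (d\<^sup>2 * k)"
      unfolding inv by (simp only: mult_2 power_add)
    also have "1 - ?p * ?Q ^ (2 * k) = (1 - qvar) * ((1 - ?p * ?Q ^ (2 * k)) / (1 - qvar))"
      using q by simp
    finally show ?thesis unfolding q_summand_eq by (simp only: power_mult_distrib mult_ac)
  qed
  then show ?thesis unfolding wp_sum_def by (simp add: sum_distrib_left)
qed

lemma qpoch_add: "qpoch a q (k + l) = qpoch a q k * qpoch (a * q ^ k) q l"
  unfolding qpoch_def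
  by (induction l) (simp_all add: power_add mult_ac)

text \<open>At a root of \<open>\<Phi>_m\<close> the sum takes the value \<open>t\<close>.\<close>

lemma loc_unit_geometric_sum:
  assumes m: "m > 0" and t: "t > 0"
  shows "loc_unit (cyclotomic m) (\<Sum>i<t. (qvar ^ m) ^ i)"
proof -
  define b :: "rat poly" where "b = (\<Sum>i<t. monom 1 (m * i))"
  have map: "map_poly of_rat b = (\<Sum>i<t. monom 1 (m * i) :: complex poly)"
    by (intro poly_eqI) (auto simp: b_def coeff_map_poly coeff_sum of_rat_sum intro!: sum.cong)
  have "coprime (cyclotomic m) b"
  proof (rule coprime_if_no_common_complex_root[OF cyclotomic_neq_0])
    fix z :: complex assume "poly (map_poly of_rat (cyclotomic m)) z = 0"
    then have "z ^ m = 1"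
      using cyclotomic_complex_root_power_eq_1_iff[OF m, of z m] by (simp add: of_rat_cyclotomic)
    then have "poly (map_poly of_rat b) z = of_nat t"
      by (simp add: map poly_sum poly_monom power_mult)
    then show "poly (map_poly of_rat b) z \<noteq> 0" using t by simp
  qed
  moreover have "b \<noteq> 0"
  proof
    assume "b = 0"
    then have "poly b 1 = 0" by simp
    then show False using t by (simp add: b_def poly_sum poly_monom)
  qed
  moreover have "to_fract b = (\<Sum>i<t. (qvar ^ m) ^ i)"
    unfolding b_def to_fract_sum
    by (rule sum.cong) (simp_all only: power_mult[symmetric] qvar_power[symmetric])
  ultimately show ?thesis using loc_unit_to_fract[of b] by (simp add: coprime_commute)
qed

lemma one_minus_qvar_ratio_in_loc:
  assumes m: "m > 0" "m dvd e" "m dvd f" "f > 0"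
  shows "(1 - qvar ^ e) / (1 - qvar ^ f) \<in> loc (cyclotomic m) 0"
proof -
  obtain s t where s: "e = m * s" and t: "f = m * t" using m by (elim dvdE)
  have t0: "t > 0" using m t by simp
  have geo: "1 - qvar ^ (m * i) = (1 - qvar ^ m) * (\<Sum>j<i. (qvar ^ m) ^ j)" for i
    unfolding power_mult by (rule one_diff_power_eq)
  have "qvar \<in> loc (cyclotomic m) 0" using loc_unit_qvar[OF m(1)] by (simp add: loc_unit_def)
  then have "(\<Sum>j<s. (qvar ^ m) ^ j) / (\<Sum>j<t. (qvar ^ m) ^ j) \<in> loc (cyclotomic m) 0"
    by (intro loc_divide loc_sum loc_power_0 loc_unit_geometric_sum m(1) t0)
  then show ?thesis
    using qvar_power_neq_1[OF m(1)] unfolding s t geo by simp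
qed

context
  fixes m d M0 :: nat
  assumes m: "m > 1" and M0: "M0 < m" "d * M0 > 0" "m dvd d * M0 - 1"
begin

private abbreviation (input) "\<phi> \<equiv> cyclotomic m"
private abbreviation (input) "p \<equiv> inverse qvar"
private abbreviation (input) "Q \<equiv> qvar ^ d"

lemma m_dvd_d_mult_iff: "m dvd d * j \<longleftrightarrow> m dvd j"
proof -
  have "coprime m d"
  proof (rule coprimeI)
    fix c assume c: "c dvd m" "c dvd d"
    then have "c dvd d * M0 - 1" "c dvd d * M0" using M0(3) by auto
    then have "c dvd d * M0 - (d * M0 - 1)" by (rule dvd_diff_nat[rotated])
    then show "is_unit c" using M0(2) by simp
  qed
  then show ?thesis by (rule coprime_dvd_mult_right_iff)
qed

lemma loc_units:
  shows "qvar ^ e \<in> loc \<phi> 0" "inverse (qvar ^ e) \<in> loc \<phi> 0" "p \<in> loc \<phi> 0" "loc_unit \<phi> (1 - qvar)"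
proof -
  have "loc_unit \<phi> (qvar ^ e)" for e using m by (intro loc_unit_power loc_unit_qvar) simp
  from this[of e] this[of 1]
  show "qvar ^ e \<in> loc \<phi> 0" "inverse (qvar ^ e) \<in> loc \<phi> 0" "p \<in> loc \<phi> 0"
    by (simp_all add: loc_unit_def)
  show "loc_unit \<phi> (1 - qvar)"
    using loc_unit_one_minus_qvar_power[of m 1] m by simp
qed

lemma d_pos: "d > 0" using M0(2) by simp

lemma denominator_unit:
  assumes "l < m"
  shows "loc_unit \<phi> (qpoch (Q * Q ^ (j * m)) Q l)"
  unfolding qpoch_def
proof (rule loc_unit_prod)
  fix i assume "i \<in> {..<l}"
  then have "\<not> m dvd Suc i" using assms by (auto dest: dvd_imp_le)
  then have "\<not> m dvd j * m + Suc i" by (metis dvd_add_right_iff dvd_triv_right)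
  then have "\<not> m dvd d * (j * m + Suc i)" unfolding m_dvd_d_mult_iff .
  moreover have "Q * Q ^ (j * m) * Q ^ i = qvar ^ (d * (j * m + Suc i))"
    unfolding power_mult[of qvar d] by (simp add: power_add)
  ultimately show "loc_unit \<phi> (1 - Q * Q ^ (j * m) * Q ^ i)"
    using loc_unit_one_minus_qvar_power[of m] m by simp
qed

lemma numerator_factor:
  "1 - p * Q ^ (j * m) * Q ^ M0 = 1 - qvar ^ (d * (j * m + M0) - 1)" "m dvd d * (j * m + M0) - 1"
proof -
  have e: "d * (j * m + M0) - 1 = m * (d * j) + (d * M0 - 1)"
    using M0(2) by (simp add: algebra_simps)
  then show "m dvd d * (j * m + M0) - 1" using M0(3) by simp
  have "Suc (d * (j * m + M0) - 1) = d * (j * m + M0)" using M0(2) by (simp add: algebra_simps)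
  then have "qvar * qvar ^ (d * (j * m + M0) - 1) = Q ^ (j * m) * Q ^ M0"
    unfolding power_Suc[symmetric] by (simp only: power_mult power_add)
  then show "1 - p * Q ^ (j * m) * Q ^ M0 = 1 - qvar ^ (d * (j * m + M0) - 1)"
    using qvar_neq_0 by (simp add: field_simps)
qed

text \<open>In a full block, numerator and denominator have exactly one factor \<open>1 - q^e\<close> with \<open>m dvd e\<close> each,
  and the quotient of these two has no pole at \<open>\<Phi>_m\<close>.\<close>

lemma block_ratio_in_loc:
  "qpoch (p * Q ^ (j * m)) Q m / qpoch (Q * Q ^ (j * m)) Q m \<in> loc \<phi> 0"
proof -
  let ?e = "d * (j * m + M0) - 1" and ?f = "d * (j * m + m)"
  obtain m' where m': "m = Suc m'" using m by (cases m) auto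
  have "qpoch (p * Q ^ (j * m)) Q m =
      (1 - p * Q ^ (j * m) * Q ^ M0) * (\<Prod>i\<in>{..<m} - {M0}. 1 - p * Q ^ (j * m) * Q ^ i)"
    unfolding qpoch_def using M0(1) by (subst prod.remove[of _ M0]) auto
  then have num: "qpoch (p * Q ^ (j * m)) Q m =
      (1 - qvar ^ ?e) * (\<Prod>i\<in>{..<m} - {M0}. 1 - p * Q ^ (j * m) * Q ^ i)"
    by (simp only: numerator_factor(1))
  have "qpoch (Q * Q ^ (j * m)) Q (Suc m') = qpoch (Q * Q ^ (j * m)) Q m' * (1 - Q * Q ^ (j * m) * Q ^ m')"
    by (simp add: qpoch_def)
  also have "Q * Q ^ (j * m) * Q ^ m' = qvar ^ ?f"
    unfolding power_mult[of qvar d] m' by (simp add: power_add)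
  finally have den: "qpoch (Q * Q ^ (j * m)) Q m = qpoch (Q * Q ^ (j * m)) Q m' * (1 - qvar ^ ?f)"
    by (simp only: m')
  have "(1 - qvar ^ ?e) / (1 - qvar ^ ?f) \<in> loc \<phi> 0"
    using m d_pos by (intro one_minus_qvar_ratio_in_loc numerator_factor(2)) simp_all
  moreover have "(\<Prod>i\<in>{..<m} - {M0}. 1 - p * Q ^ (j * m) * Q ^ i) / qpoch (Q * Q ^ (j * m)) Q m' \<in> loc \<phi> 0"
    by (intro loc_divide loc_prod loc_diff loc_mult_left loc_1 loc_units loc_power_0 denominator_unit) (simp add: m')
  ultimately have "(1 - qvar ^ ?e) / (1 - qvar ^ ?f) *
     ((\<Prod>i\<in>{..<m} - {M0}. 1 - p * Q ^ (j * m) * Q ^ i) / qpoch (Q * Q ^ (j * m)) Q m') \<in> loc \<phi> 0"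
    by (rule loc_mult_left)
  then show ?thesis unfolding num den by (simp add: mult.commute)
qed

lemma q_ratio_add:
  "q_ratio d (k + l) = q_ratio d k * (qpoch (p * Q ^ k) Q l / qpoch (Q * Q ^ k) Q l)"
  unfolding q_ratio_def qpoch_add by simp

lemma q_ratio_block_in_loc: "q_ratio d (j * m) \<in> loc \<phi> 0"
proof (induction j)
  case (Suc j)
  have "q_ratio d (Suc j * m) = q_ratio d (j * m + m)" by (simp add: add.commute)
  then show ?case unfolding q_ratio_add using Suc block_ratio_in_loc by (simp only: loc_mult_left)
qed (simp add: q_ratio_def qpoch_def)

text \<open>Within a block the recursion factors depend only on \<open>Q^k\<close>, and \<open>Q^{j m} = 1\<close> modulo \<open>\<Phi>_m\<close>.\<close>

lemma loc_cong_q_ratio_block: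
  assumes l: "l < m"
  shows "loc_cong \<phi> (q_ratio d (j * m + l)) (q_ratio d (j * m) * q_ratio d l)"
proof -
  have Q: "loc_cong \<phi> (Q ^ (j * m)) 1"
    using loc_cong_qvar_power[of m 0 "d * (j * m)"] m
    by (simp add: power_mult loc_cong_def) (metis loc_uminus minus_diff_eq)
  have qp: "loc_cong \<phi> (qpoch (a * Q ^ (j * m)) Q l) (qpoch a Q l)" if "a \<in> loc \<phi> 0" for a
    unfolding qpoch_def
    using loc_cong_mult[OF loc_cong_refl[OF that] Q] loc_units(1)[of 1]
    by (intro loc_cong_prod loc_cong_diff loc_cong_mult loc_cong_refl loc_1 loc_power_0) simp_all
  have nz: "qpoch (Q * Q ^ (j * m)) Q l \<noteq> 0"
    using qpoch_qvar_neq_0[OF d_pos, of "j * m + l"] unfolding qpoch_add by simp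
  have "loc_cong \<phi> (qpoch (p * Q ^ (j * m)) Q l * inverse (qpoch (Q * Q ^ (j * m)) Q l))
     (qpoch p Q l * inverse (qpoch Q Q l))"
    using denominator_unit[OF l, of j] denominator_unit[OF l, of 0] nz qpoch_qvar_neq_0[OF d_pos]
    by (intro loc_cong_mult loc_cong_inverse qp loc_units) simp_all
  then show ?thesis
    unfolding q_ratio_add q_ratio_def[of d l] divide_inverse
    by (intro loc_cong_mult[OF loc_cong_refl[OF q_ratio_block_in_loc]])
qed

lemma loc_cong_q_summand_block:
  assumes l: "l < m"
  shows "loc_cong \<phi> (q_summand d (j * m + l)) (q_ratio d (j * m) ^ (2 * d) * q_summand d l)"
proof -
  have Q: "loc_cong \<phi> (qvar ^ (e * (j * m + l))) (qvar ^ (e * l))" for e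
  proof -
    have "loc_cong \<phi> (qvar ^ (e * l)) (qvar ^ (e * (j * m + l)))"
      using m by (intro loc_cong_qvar_power) (simp_all add: algebra_simps)
    then show ?thesis unfolding loc_cong_def using loc_uminus by force
  qed
  have "loc_cong \<phi> ((1 - p * qvar ^ (2 * d * (j * m + l))) * inverse (1 - qvar) *
      q_ratio d (j * m + l) ^ (2 * d) * qvar ^ (d\<^sup>2 * (j * m + l)))
     ((1 - p * qvar ^ (2 * d * l)) * inverse (1 - qvar) *
      (q_ratio d (j * m) * q_ratio d l) ^ (2 * d) * qvar ^ (d\<^sup>2 * l))"
    using loc_units(4)
    by (intro loc_cong_mult loc_cong_diff loc_cong_power Q loc_cong_q_ratio_block[OF l] loc_cong_refl loc_units loc_1)
       (simp add: loc_unit_def)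
  moreover have QQ: "Q ^ (2 * k) = qvar ^ (2 * d * k)" for k
    by (simp add: mult_ac flip: power_mult)
  ultimately show ?thesis
    unfolding q_summand_eq divide_inverse QQ by (simp only: power_mult_distrib mult_ac)
qed

text \<open>For \<open>l > M0\<close> the numerator contains \<open>1 - p Q^{M0} = 1 - q^{d M0 - 1}\<close>.\<close>

lemma q_ratio_tail_in_loc:
  assumes l: "M0 < l" "l < m"
  shows "q_ratio d l \<in> loc \<phi> 1"
proof -
  have "qpoch p Q l = (1 - p * Q ^ M0) * (\<Prod>i\<in>{..<l} - {M0}. 1 - p * Q ^ i)"
    unfolding qpoch_def using l by (subst prod.remove[of _ M0]) auto
  also have "1 - p * Q ^ M0 = 1 - qvar ^ (d * M0 - 1)"
    using numerator_factor(1)[of 0] by simp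
  finally have num: "qpoch p Q l = (1 - qvar ^ (d * M0 - 1)) * (\<Prod>i\<in>{..<l} - {M0}. 1 - p * Q ^ i)" .
  have "1 - qvar ^ (d * M0 - 1) \<in> loc \<phi> 1"
    using m M0(3) by (intro one_minus_qvar_power_in_loc) simp_all
  then have "qpoch p Q l \<in> loc \<phi> 1"
    unfolding num by (rule loc_mult_right) (intro loc_prod loc_diff loc_mult_left loc_1 loc_units loc_power_0)
  then show ?thesis
    unfolding q_ratio_def using denominator_unit[OF l(2), of 0] by (intro loc_divide) simp_all
qed

lemma q_summand_tail_in_loc:
  assumes l: "M0 < l" "l < m"
  shows "q_summand d l \<in> loc \<phi> (2 * d)"
  unfolding q_summand_eq
  using loc_power[OF q_ratio_tail_in_loc[OF l], of "2 * d"] loc_units(4)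
  by (intro loc_mult_right[OF loc_mult_left] loc_divide loc_diff loc_1 loc_mult_left[OF _ loc_power_0] loc_units) simp_all

lemma q_summand_partial_sum_in_loc:
  assumes "L = M0 \<or> L = m - 1"
  shows "(\<Sum>l\<le>L. q_summand d l) \<in> loc \<phi> 1"
proof -
  have "q_family d M0 1 1 \<in> loc \<phi> 1"
    using m M0 by (intro wp_sum_qvar_in_loc_1) simp_all
  moreover have "loc_unit \<phi> ((1 - qvar) * qpoch Q Q M0 ^ (2 * d))"
    using denominator_unit[OF M0(1), of 0] by (intro loc_unit_mult loc_unit_power loc_units) simp
  ultimately have "q_family d M0 1 1 / ((1 - qvar) * qpoch Q Q M0 ^ (2 * d)) \<in> loc \<phi> 1"
    by (rule loc_divide)
  then have *: "(\<Sum>l\<le>M0. q_summand d l) \<in> loc \<phi> 1"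
    unfolding q_family_1_1[OF d_pos] using qpoch_qvar_neq_0[OF d_pos, of M0] qvar_neq_1 by simp
  have "(\<Sum>l\<in>{Suc M0..m - 1}. q_summand d l) \<in> loc \<phi> 1"
    using m d_pos by (intro loc_sum loc_antimono[OF _ q_summand_tail_in_loc]) auto
  with * have "(\<Sum>l\<le>M0. q_summand d l) + (\<Sum>l\<in>{Suc M0..m - 1}. q_summand d l) \<in> loc \<phi> 1"
    by (rule loc_add)
  also have "(\<Sum>l\<le>M0. q_summand d l) + (\<Sum>l\<in>{Suc M0..m - 1}. q_summand d l) = (\<Sum>l\<le>m - 1. q_summand d l)"
    using M0(1) by (subst sum.union_disjoint[symmetric]) (auto intro!: sum.cong)
  finally show ?thesis using * assms by auto
qed

lemma q_summand_block_sum_in_loc: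
  assumes "L = M0 \<or> L = m - 1"
  shows "(\<Sum>l\<le>L. q_summand d (j * m + l)) \<in> loc \<phi> 1"
proof -
  have "loc_cong \<phi> (\<Sum>l\<le>L. q_summand d (j * m + l)) (\<Sum>l\<le>L. q_ratio d (j * m) ^ (2 * d) * q_summand d l)"
    using assms M0(1) m by (intro loc_cong_sum loc_cong_q_summand_block) auto
  moreover have "(\<Sum>l\<le>L. q_ratio d (j * m) ^ (2 * d) * q_summand d l) \<in> loc \<phi> 1"
    unfolding sum_distrib_left[symmetric]
    by (intro loc_mult_left loc_power_0 q_ratio_block_in_loc q_summand_partial_sum_in_loc assms)
  ultimately show ?thesis unfolding loc_cong_def using loc_add by force
qed

lemma q_summand_sum_in_loc_1:
  assumes "L = M0 \<or> L = m - 1"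
  shows "(\<Sum>k\<le>j * m + L. q_summand d k) \<in> loc \<phi> 1"
proof -
  have split: "(\<Sum>k<a + b. q_summand d k) = (\<Sum>k<a. q_summand d k) + (\<Sum>l<b. q_summand d (a + l))" for a b
    by (induction b) (simp_all add: add.assoc)
  have full: "(\<Sum>k<j * m. q_summand d k) \<in> loc \<phi> 1" for j
  proof (induction j)
    case (Suc j)
    have "Suc j * m = j * m + Suc (m - 1)" using m by simp
    then have "(\<Sum>k<Suc j * m. q_summand d k) = (\<Sum>k<j * m. q_summand d k) + (\<Sum>l\<le>m - 1. q_summand d (j * m + l))"
      by (simp only: split lessThan_Suc_atMost)
    then show ?case using loc_add[OF Suc q_summand_block_sum_in_loc] by simp
  qed simp
  have "(\<Sum>k\<le>j * m + L. q_summand d k) = (\<Sum>k<j * m. q_summand d k) + (\<Sum>l\<le>L. q_summand d (j * m + l))"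
    using split[of "j * m" "Suc L"] by (simp only: add_Suc_right lessThan_Suc_atMost)
  then show ?thesis using loc_add[OF full q_summand_block_sum_in_loc[OF assms]] by simp
qed

end

section \<open>The congruence\<close>

lemma prod_dvd_of_pairwise_coprime:
  fixes f :: "'i \<Rightarrow> 'a :: ring_gcd"
  assumes "finite A" "\<And>i. i \<in> A \<Longrightarrow> f i dvd x"
    "\<And>i j. i \<in> A \<Longrightarrow> j \<in> A \<Longrightarrow> i \<noteq> j \<Longrightarrow> coprime (f i) (f j)"
  shows "prod f A dvd x"
  using assms
proof (induction A rule: finite_induct)
  case (insert a A)
  have "coprime (f a) (prod f A)"
    using insert.prems(2) insert.hyps by (intro prod_coprime_right) auto
  moreover have "f a dvd x" "prod f A dvd x" using insert by auto
  ultimately show ?case using insert.hyps by (simp add: divides_mult)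
qed simp

theorem mainTheorem3:
  fixes d n :: nat
  assumes "d \<ge> 3" and "n > 1" and "[n = 1] (mod d)"
  shows "\<forall>M \<in> {((d - 1) * n + 1) div d, n - 1}.
    ratfun_cong
      (\<Sum>k=0..M. qint qvar (2 * int d * int k - 1)
        * (qpoch (inverse qvar) (qvar ^ d) k ^ (2 * d) / qpoch (qvar ^ d) (qvar ^ d) k ^ (2 * d))
        * qvar ^ (d\<^sup>2 * k))
      0
      (qint_poly n * cyclotomic n ^ 3)"
proof
  fix M assume M: "M \<in> {((d - 1) * n + 1) div d, n - 1}"
  obtain l where n: "n = d * Suc l + 1"
  proof -
    have "d dvd n - 1" using assms by (simp add: cong_altdef_nat)
    then obtain c where c: "n - 1 = d * c" by (elim dvdE)
    then have "c \<noteq> 0" using assms(2) by (intro notI) simp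
    then obtain l where "c = Suc l" by (cases c) auto
    with c assms(2) show thesis by (intro that[of l]) simp
  qed
  define M1 where "M1 = (d - 1) * Suc l + 1"
  have dM1: "d * M1 = (d - 1) * n + 1"
    using assms(1) unfolding M1_def n by (cases d) (simp_all add: algebra_simps)
  then have M1: "((d - 1) * n + 1) div d = M1"
    using assms(1) by (metis nonzero_mult_div_cancel_left not_numeral_le_zero)
  have M': "M = M1 \<or> M = n - 1" using M unfolding M1 by simp
  have M1_less: "M1 < n"
  proof -
    have "(d - 1) * Suc l < d * Suc l" using assms(1) by (intro mult_less_mono1) simp_all
    then show ?thesis by (simp add: M1_def n)
  qed
  define S where "S = (\<Sum>k\<le>M. q_summand d k)"
  define N where "N = fst (quot_of_fract S)"
  have "S \<in> loc (cyclotomic n) 4"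
  proof -
    have M0: "n > 1" "M1 < n" "d * M1 > 0" "n dvd d * M1 - 1"
      using assms M1_less by (simp_all add: dM1)
    have "loc_unit (cyclotomic n) ((1 - qvar) * qpoch (qvar ^ d) (qvar ^ d) M1 ^ (2 * d))"
      using denominator_unit[OF M0 M1_less, of 0] loc_units[OF M0]
      by (intro loc_unit_mult loc_unit_power) simp_all
    moreover have "q_family d M1 1 1 \<in> loc (cyclotomic n) 4"
      using assms(1) by (intro q_family_in_loc_4[OF _ n M1_def]) simp
    ultimately have "q_family d M1 1 1 / ((1 - qvar) * qpoch (qvar ^ d) (qvar ^ d) M1 ^ (2 * d)) \<in> loc (cyclotomic n) 4"
      by (intro loc_divide)
    then have *: "(\<Sum>k\<le>M1. q_summand d k) \<in> loc (cyclotomic n) 4"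
      using assms(1) qpoch_qvar_neq_0[of d M1] qvar_neq_1 by (subst (asm) q_family_1_1) simp_all
    have "(\<Sum>k\<in>{Suc M1..n - 1}. q_summand d k) \<in> loc (cyclotomic n) 4"
      using assms(1,2) by (intro loc_sum loc_antimono[OF _ q_summand_tail_in_loc[OF M0]]) auto
    with * have "(\<Sum>k\<le>M1. q_summand d k) + (\<Sum>k\<in>{Suc M1..n - 1}. q_summand d k) \<in> loc (cyclotomic n) 4"
      by (rule loc_add)
    also have "(\<Sum>k\<le>M1. q_summand d k) + (\<Sum>k\<in>{Suc M1..n - 1}. q_summand d k) = (\<Sum>k\<le>n - 1. q_summand d k)"
      using M1_less by (subst sum.union_disjoint[symmetric]) (auto intro!: sum.cong)
    finally show ?thesis using * M' by (auto simp: S_def)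
  qed
  then have n4: "cyclotomic n ^ 4 dvd N" unfolding N_def by (rule loc_imp_dvd_numerator)
  have m1: "cyclotomic m dvd N" if m: "m dvd n" "m > 1" for m
  proof -
    \<comment> \<open>The reflection modulo \<open>\<Phi>_m\<close> has its centre at half of the residue of \<open>M1\<close>, as \<open>d * M1 = 1\<close> modulo \<open>m\<close>.\<close>
    define M0 where "M0 = M1 mod m"
    have mM1: "m dvd d * M1 - 1" using m by (simp add: dM1)
    have "M0 \<noteq> 0"
    proof
      assume "M0 = 0"
      then have "m dvd d * M1" by (auto simp: M0_def)
      then have "m dvd d * M1 - (d * M1 - 1)" using mM1 by (rule dvd_diff_nat)
      then show False using m dM1 by simp
    qed
    then have pos: "d * M0 > 0" using assms(1) by simp
    have M1_eq: "M1 = (M1 div m) * m + M0" by (simp add: M0_def)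
    have "d * M1 - 1 = m * (d * (M1 div m)) + (d * M0 - 1)"
      using pos by (subst M1_eq) (simp add: algebra_simps)
    then have dvd: "m dvd d * M0 - 1" using mM1 by (metis dvd_add_right_iff dvd_triv_left)
    have M0: "m > 1" "M0 < m" "d * M0 > 0" "m dvd d * M0 - 1"
      using m pos dvd by (simp_all add: M0_def)
    have "\<exists>j L. M = j * m + L \<and> (L = M0 \<or> L = m - 1)"
    proof (cases "M = M1")
      case True
      then show ?thesis using M1_eq by blast
    next
      case False
      then have "M = n - 1" using M' by auto
      moreover obtain c where c: "n = m * c" using m by (elim dvdE)
      moreover have "c > 0" using c assms(2) by (intro gr0I) simp
      ultimately have "M = (c - 1) * m + (m - 1)"
        using m by (cases c) (simp_all add: algebra_simps)
      then show ?thesis by blast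
    qed
    then have "S \<in> loc (cyclotomic m) 1"
      unfolding S_def using q_summand_sum_in_loc_1[OF M0] by auto
    then show ?thesis unfolding N_def using loc_imp_dvd_numerator by fastforce
  qed
  define A where "A = {m. m dvd n} - {1, n}"
  have fin: "finite A" using assms(2) by (simp add: A_def)
  have pos: "m > 0" if "m \<in> insert n A" for m
    using that assms(2) by (auto simp: A_def intro!: Nat.gr0I)
  define f where "f m = (if m = n then cyclotomic n ^ 4 else cyclotomic m)" for m
  have "prod f (insert n A) dvd N"
  proof (rule prod_dvd_of_pairwise_coprime)
    show "finite (insert n A)" using fin by simp
    show "f m dvd N" if "m \<in> insert n A" for m
    proof (cases "m = n")
      case False
      then have "m dvd n" "m > 1" using that pos[OF that] by (auto simp: A_def)
      then show ?thesis using m1 False by (simp add: f_def)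
    qed (use n4 in \<open>simp add: f_def\<close>)
    show "coprime (f i) (f j)" if "i \<in> insert n A" "j \<in> insert n A" "i \<noteq> j" for i j
      using coprime_cyclotomic[OF pos[OF that(1)] pos[OF that(2)] that(3)] that(3) by (auto simp: f_def)
  qed
  also have "prod f (insert n A) = cyclotomic n ^ 4 * prod cyclotomic A"
  proof -
    have "prod f A = prod cyclotomic A" by (rule prod.cong) (auto simp: f_def A_def)
    then show ?thesis using fin by (simp add: A_def f_def)
  qed
  also have "\<dots> = qint_poly n * cyclotomic n ^ 3"
  proof -
    have "{m. m dvd n} - {1} = insert n A" using assms(2) by (auto simp: A_def)
    then have "qint_poly n = cyclotomic n * prod cyclotomic A"
      using assms(2) fin by (simp add: qint_poly_eq_prod_cyclotomic A_def)
    then show ?thesis by (simp add: eval_nat_numeral mult_ac)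
  qed
  finally show "ratfun_cong
      (\<Sum>k=0..M. qint qvar (2 * int d * int k - 1)
        * (qpoch (inverse qvar) (qvar ^ d) k ^ (2 * d) / qpoch (qvar ^ d) (qvar ^ d) k ^ (2 * d))
        * qvar ^ (d\<^sup>2 * k))
      0
      (qint_poly n * cyclotomic n ^ 3)"
    unfolding ratfun_cong_def N_def S_def q_summand_def by (simp add: atLeast0AtMost)
qed

end
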